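(* For a Girard quantale $\mathcal{Q}$, let $U_\pm(\mathcal{Q})$ be the reflexive subframe of the implication frame $U^{\otimes\neg\oplus}(\mathcal{Q})$ (that is, the restriction of $U^{\otimes\neg\oplus}(\mathcal{Q})$ to its reflexive elements), and for a morphism $f$ of $\mathsf{GQ}$ let $U_\pm f$ be the restriction of $U^{\otimes\neg\oplus}f$ to reflexive elements. Then $U_\pm\colon \mathsf{GQ}\to\mathsf{IF}^{\rm r}_\pm$ is a functor, and it is right adjoint to $F_\pm := F^{\otimes\neg\oplus}\circ\iota^{\rm r}\colon \mathsf{IF}^{\rm r}_\pm\to\mathsf{GQ}$.
   Context: All monoids and quantales are commutative and unital. $\mathbb{N}[X]$ is the set of finite multisets of elements of $X$, a commutative monoid under multiset union, and $\mathbb{N}[X+X]\cong\mathbb{N}[X]\times\mathbb{N}[X]$. **Girard quantales.** A Girard quantale is a quantale $\mathcal{Q}=(Q,\otimes,I,\le)$ with a dualizing element $\bot_{\mathcal{Q}}$ (not necessarily the bottom): writing $a^\bot:=\bigvee\{c\mid c\otimes a\le\bot_{\mathcal{Q}}\}$, one has $a^{\bot\bot}=a$ for all $a$. $\mathsf{GQ}$ is the category of Girard quantales whose morphisms are quantale homomorphisms $f$ (preserving arbitrary joins, $\otimes$ and unit) with $f(\bot)\le\bot$. **Implication frames.** An implication frame is a set $X$ with a subset $\bot\subseteq\mathbb{N}[X+X]$; elements of $\mathbb{N}[X+X]$ are positions. For a position $p$, $p^\bot:=\{p'\mid p+p'\in\bot\}$, and for a set $A$ of positions, $A^\bot:=\bigcap_{p\in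 A}p^\bot$. $\mathsf{IF}_\pm$ is the category of implication frames; a morphism $(X,\bot_X)\to(Y,\bot_Y)$ is a function $f\colon X\to Y$ such that, with $f\times f$ the induced map on positions, $(f\times f)(\bot_X)\subseteq\bot_Y$ and, for all $A,B\subseteq\mathbb{N}[X+X]$, $A^\bot\subseteq B^\bot$ implies $(f\times f)(A)^\bot\subseteq(f\times f)(B)^\bot$ (continuity). An element $x\in X$ is reflexive if $(\{x\},\{x\})\in\bot$; a frame is reflexive if all its elements are. $\iota^{\rm r}\colon\mathsf{IF}^{\rm r}_\pm\rightarrowtail\mathsf{IF}_\pm$ is the full subcategory of reflexive frames. The restriction of a frame $(X,\bot)$ to $X'\subseteq X$ is $(X',\bot\cap\mathbb{N}[X'+X'])$. **The functors.** $F^{\otimes\neg\oplus}\colon\mathsf{IF}_\pm\to\mathsf{GQ}$ sends $(X,\bot)$ to the Girard quantale of subsets $A\subseteq\mathbb{N}[X+X]$ with $A^{\bot\bot}=A$, ordered by inclusion, with $A\otimes B=\{a+b\mid a\in A,b\in B\}^{\bot\bot}$, joins $(\bigcup_i A_i)^{\bot\bot}$, and dualizing element $\bot$; it sends a morphism $f$ to $A\mapsto (f\times f)(A)^{\bot\bot}$. $U^{\otimes\neg\oplus}\colon\mathsf{GQ}\to\mathsf{IF}_\pm$ sends $\mathcal{Q}$ to the frame with underlying set $Q^2$ (elements $\langle a_+,a_-\rangle$), in which a position $(\Gamma,\Delta)$ is in $\bot$ iff $\bigotimes_{\langle a_+,a_-\rangle\in\Gamma}a_+\otimes\bigotimes_{\langle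 b_+,b_-\rangle\in\Delta}b_-\le\bot_{\mathcal{Q}}$ (products taken with multiplicity); it sends $f$ to $f\times f\colon Q^2\to Q'^2$. *)

theory Defs
  imports
    "HOL-Algebra.Complete_Lattice"
    "HOL-Algebra.FiniteProduct"
    "HOL-Library.FuncSet"
    "HOL-Library.Multiset"
    "HOL-Library.Product_Plus"
begin

text \<open>
  Objects of both categories are sets with structure, carried by a subset of an arbitrary type.
  Morphisms are extensional functions on the carrier, so that equality of functions is
  equality of morphisms; composition is \<^const>\<open>compose\<close>.
\<close>

record 'a quantale = "'a monoid" +
  qle :: "['a, 'a] \<Rightarrow> bool"

record 'a girard = "'a quantale" +
  dualizer :: 'a

definition qord :: "('a, 'm) quantale_scheme \<Rightarrow> 'a gorder" where
  "qord Q = \<lparr>carrier = carrier Q, eq = (=), le = qle Q\<rparr>"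

definition qjoin :: "('a, 'm) quantale_scheme \<Rightarrow> 'a set \<Rightarrow> 'a" where
  "qjoin Q A = \<Squnion>\<^bsub>qord Q\<^esub> A"

locale comm_quantale = comm_monoid Q for Q :: "('a, 'm) quantale_scheme" (structure) +
  assumes complete: "complete_lattice (qord Q)"
    and mult_qjoin:
      "\<lbrakk>a \<in> carrier Q; B \<subseteq> carrier Q\<rbrakk> \<Longrightarrow> a \<otimes> qjoin Q B = qjoin Q ((\<lambda>b. a \<otimes> b) ` B)"

definition qneg :: "('a, 'm) girard_scheme \<Rightarrow> 'a \<Rightarrow> 'a" where
  "qneg Q a = qjoin Q {c \<in> carrier Q. qle Q (c \<otimes>\<^bsub>Q\<^esub> a) (dualizer Q)}"

locale girard_quantale = comm_quantale Q for Q :: "('a, 'm) girard_scheme" (structure) +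
  assumes dualizer_closed: "dualizer Q \<in> carrier Q"
    and qneg_qneg: "a \<in> carrier Q \<Longrightarrow> qneg Q (qneg Q a) = a"

definition gq_hom :: "'a girard \<Rightarrow> 'b girard \<Rightarrow> ('a \<Rightarrow> 'b) set" where
  "gq_hom Q R = {f \<in> carrier Q \<rightarrow>\<^sub>E carrier R.
     (\<forall>A \<subseteq> carrier Q. f (qjoin Q A) = qjoin R (f ` A)) \<and>
     (\<forall>a \<in> carrier Q. \<forall>b \<in> carrier Q. f (a \<otimes>\<^bsub>Q\<^esub> b) = f a \<otimes>\<^bsub>R\<^esub> f b) \<and>
     f \<one>\<^bsub>Q\<^esub> = \<one>\<^bsub>R\<^esub> \<and>
     qle R (f (dualizer Q)) (dualizer R)}"

text \<open>\<open>\<nat>[X + X]\<close> is represented as \<open>\<nat>[X] \<times> \<nat>[X]\<close>; addition and zero are componentwise.\<close>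

type_synonym 'x position = "'x multiset \<times> 'x multiset"

definition positions :: "'x set \<Rightarrow> 'x position set" where
  "positions S = {p. set_mset (fst p) \<subseteq> S \<and> set_mset (snd p) \<subseteq> S}"

definition pos_map :: "('x \<Rightarrow> 'y) \<Rightarrow> 'x position \<Rightarrow> 'y position" where
  "pos_map f = map_prod (image_mset f) (image_mset f)"

record 'x iframe = "'x partial_object" +
  falsum :: "'x position set"

definition implication_frame :: "'x iframe \<Rightarrow> bool" where
  "implication_frame X \<longleftrightarrow> falsum X \<subseteq> positions (carrier X)"

text \<open>Relativised to the positions of the frame: \<open>perp X {}\<close> is the set of all its positions.\<close>

definition perp :: "'x iframe \<Rightarrow> 'x position set \<Rightarrow> 'x position set" where
  "perp X A = {p' \<in> positions (carrier X). \<forall>p \<in> A. p + p' \<in> falsum X}"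

abbreviation biperp :: "'x iframe \<Rightarrow> 'x position set \<Rightarrow> 'x position set" where
  "biperp X A \<equiv> perp X (perp X A)"

definition if_hom :: "'x iframe \<Rightarrow> 'y iframe \<Rightarrow> ('x \<Rightarrow> 'y) set" where
  "if_hom X Y = {f \<in> carrier X \<rightarrow>\<^sub>E carrier Y.
     pos_map f ` falsum X \<subseteq> falsum Y \<and>
     (\<forall>A \<subseteq> positions (carrier X). \<forall>B \<subseteq> positions (carrier X).
        perp X A \<subseteq> perp X B \<longrightarrow> perp Y (pos_map f ` A) \<subseteq> perp Y (pos_map f ` B))}"

definition reflexive_points :: "'x iframe \<Rightarrow> 'x set" where
  "reflexive_points X = {x \<in> carrier X. ({#x#}, {#x#}) \<in> falsum X}"

definition reflexive_frame :: "'x iframe \<Rightarrow> bool" where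
  "reflexive_frame X \<longleftrightarrow> implication_frame X \<and> reflexive_points X = carrier X"

definition frame_restrict :: "'x iframe \<Rightarrow> 'x set \<Rightarrow> 'x iframe" where
  "frame_restrict X S = \<lparr>carrier = S, falsum = falsum X \<inter> positions S\<rparr>"

text \<open>
  Joins are determined by the order; the unit is the closure of the empty position.
  Since the reflexive frames form a full subcategory, precomposing with the inclusion changes
  neither the object part nor the morphism part.
\<close>

definition F_obj :: "'x iframe \<Rightarrow> 'x position set girard" where
  "F_obj X = \<lparr>
     carrier = {A. A \<subseteq> positions (carrier X) \<and> biperp X A = A},
     monoid.mult = (\<lambda>A B. biperp X {a + b |a b. a \<in> A \<and> b \<in> B}),
     one = biperp X {0},
     qle = (\<subseteq>),
     dualizer = falsum X\<rparr>"

definition F_map ::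
    "'x iframe \<Rightarrow> 'y iframe \<Rightarrow> ('x \<Rightarrow> 'y) \<Rightarrow> 'x position set \<Rightarrow> 'y position set" where
  "F_map X Y f = (\<lambda>A \<in> carrier (F_obj X). biperp Y (pos_map f ` A))"

text \<open>Products with multiplicity: each member of the support occurs to the power of its count.\<close>

definition mset_prod :: "('a, 'm) monoid_scheme \<Rightarrow> ('x \<Rightarrow> 'a) \<Rightarrow> 'x multiset \<Rightarrow> 'a" where
  "mset_prod Q h M = (\<Otimes>\<^bsub>Q\<^esub>x \<in> set_mset M. h x [^]\<^bsub>Q\<^esub> count M x)"

definition U_obj :: "'a girard \<Rightarrow> ('a \<times> 'a) iframe" where
  "U_obj Q = \<lparr>
     carrier = carrier Q \<times> carrier Q,
     falsum = {(\<Gamma>, \<Delta>) \<in> positions (carrier Q \<times> carrier Q).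
       qle Q (mset_prod Q fst \<Gamma> \<otimes>\<^bsub>Q\<^esub> mset_prod Q snd \<Delta>) (dualizer Q)}\<rparr>"

definition U_map :: "'a girard \<Rightarrow> ('a \<Rightarrow> 'b) \<Rightarrow> 'a \<times> 'a \<Rightarrow> 'b \<times> 'b" where
  "U_map Q f = (\<lambda>x \<in> carrier (U_obj Q). map_prod f f x)"

definition Upm_obj :: "'a girard \<Rightarrow> ('a \<times> 'a) iframe" where
  "Upm_obj Q = frame_restrict (U_obj Q) (reflexive_points (U_obj Q))"

definition Upm_map :: "'a girard \<Rightarrow> ('a \<Rightarrow> 'b) \<Rightarrow> 'a \<times> 'a \<Rightarrow> 'b \<times> 'b" where
  "Upm_map Q f = restrict (U_map Q f) (reflexive_points (U_obj Q))"

text \<open>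
  An adjunction is a family of bijections between hom-sets, indexed by objects over arbitrary
  types. A variable of HOL cannot stand for such a type-polymorphic family, so the family is a
  constant: the transpose of \<open>g\<close> is \<open>g\<close> after the unit, which sends \<open>x\<close> to the pair of the
  closures of the two singleton positions at \<open>x\<close>.
\<close>

definition adj_transpose :: "'x iframe \<Rightarrow> ('x position set \<Rightarrow> 'a) \<Rightarrow> 'x \<Rightarrow> 'a \<times> 'a" where
  "adj_transpose X g =
     (\<lambda>x \<in> carrier X. (g (biperp X {({#x#}, {#})}), g (biperp X {({#}, {#x#})})))"

end

theory Submission
  imports Defs "HOL-Library.Set_Algebras"
begin

text \<open>
  A position of \<open>U\<^sub>\<plusminus> Q\<close> has a value in \<open>Q\<close>, the product of its components, and it lies in \<open>\<bottom>\<close>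
  iff its value is below the dualizing element. Every element of \<open>Q\<close> is the value of a
  position, so \<open>A\<^sup>\<bottom> \<subseteq> B\<^sup>\<bottom>\<close> holds iff the join of the values of \<open>B\<close> is below that of \<open>A\<close>.
  A closed set is the join of the closures of its singletons, and the closure of a singleton is
  the product of the closures of its generators. Hence a morphism \<open>g\<close> out of \<open>F X\<close> is
  recovered from its transpose \<open>t\<close> by sending \<open>A\<close> to the join of the values of \<open>(t \<times> t)(A)\<close>;
  conversely, continuity of \<open>t\<close> says precisely that this join depends only on the closure
  of \<open>A\<close>.
\<close>

subsection \<open>Quantales\<close>

context comm_quantale
begin

interpretation L: complete_lattice "qord Q"
  by (rule complete)

lemma qle_refl: "a \<in> carrier Q \<Longrightarrow> qle Q a a"
  using L.le_refl[of a] by (simp add: qord_def)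

lemma qle_trans:
  "\<lbrakk>qle Q a b; qle Q b c; a \<in> carrier Q; b \<in> carrier Q; c \<in> carrier Q\<rbrakk> \<Longrightarrow> qle Q a c"
  using L.le_trans[of a b c] by (simp add: qord_def)

lemma qle_antisym: "\<lbrakk>qle Q a b; qle Q b a; a \<in> carrier Q; b \<in> carrier Q\<rbrakk> \<Longrightarrow> a = b"
  using L.le_antisym[of a b] by (simp add: qord_def)

lemma qjoin_closed: "A \<subseteq> carrier Q \<Longrightarrow> qjoin Q A \<in> carrier Q"
  using L.sup_closed[of A] by (simp add: qord_def qjoin_def)

lemma qjoin_upper: "\<lbrakk>a \<in> A; A \<subseteq> carrier Q\<rbrakk> \<Longrightarrow> qle Q a (qjoin Q A)"
  using L.sup_upper[of A a] by (simp add: qord_def qjoin_def)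

lemma qjoin_least:
  "\<lbrakk>A \<subseteq> carrier Q; b \<in> carrier Q; \<And>a. a \<in> A \<Longrightarrow> qle Q a b\<rbrakk> \<Longrightarrow> qle Q (qjoin Q A) b"
  using L.sup_least[of A b] by (simp add: qord_def qjoin_def Upper_def subset_iff)

lemma qjoin_le_iff:
  "\<lbrakk>A \<subseteq> carrier Q; b \<in> carrier Q\<rbrakk> \<Longrightarrow> qle Q (qjoin Q A) b \<longleftrightarrow> (\<forall>a \<in> A. qle Q a b)"
  by (meson qjoin_closed qjoin_least qjoin_upper qle_trans subset_iff)

lemma qjoin_eqI:
  assumes "A \<subseteq> carrier Q" "b \<in> carrier Q"
    and "\<And>a. a \<in> A \<Longrightarrow> qle Q a b"
    and "\<And>c. \<lbrakk>c \<in> carrier Q; \<And>a. a \<in> A \<Longrightarrow> qle Q a c\<rbrakk> \<Longrightarrow> qle Q b c"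
  shows "qjoin Q A = b"
  by (rule qle_antisym) (use assms qjoin_closed qjoin_least qjoin_upper in auto)

text \<open>Recasts the order as an equation between joins, so that every join-preserving map is
  monotone. Multiplication by a fixed element (\<open>mult_mono\<close>) and quantale homomorphisms
  (\<open>gq_hom_mono\<close>) are the two instances.\<close>

lemma qjoin_insert_le:
  "\<lbrakk>qle Q a b; a \<in> carrier Q; b \<in> carrier Q\<rbrakk> \<Longrightarrow> qjoin Q {a, b} = b"
  by (rule qjoin_eqI) (auto simp: qle_refl)

lemma qjoin_singleton: "a \<in> carrier Q \<Longrightarrow> qjoin Q {a} = a"
  using qjoin_insert_le[of a a] by (simp add: qle_refl)

lemma qjoin_UN:
  assumes "\<And>i. i \<in> I \<Longrightarrow> A i \<subseteq> carrier Q"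
  shows "qjoin Q (\<Union>i\<in>I. A i) = qjoin Q ((\<lambda>i. qjoin Q (A i)) ` I)"
proof (rule sym, rule qjoin_eqI)
  show "(\<lambda>i. qjoin Q (A i)) ` I \<subseteq> carrier Q"
    using assms qjoin_closed by auto
  show U: "qjoin Q (\<Union>i\<in>I. A i) \<in> carrier Q"
    using assms by (intro qjoin_closed) auto
  fix a assume "a \<in> (\<lambda>i. qjoin Q (A i)) ` I"
  then obtain i where i: "i \<in> I" "a = qjoin Q (A i)" by auto
  show "qle Q a (qjoin Q (\<Union>i\<in>I. A i))"
    unfolding i(2)
  proof (rule qjoin_least[OF assms[OF i(1)] U])
    fix b assume "b \<in> A i"
    then show "qle Q b (qjoin Q (\<Union>i\<in>I. A i))"
      using i assms by (intro qjoin_upper) auto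
  qed
next
  fix c assume c: "c \<in> carrier Q" "\<And>a. a \<in> (\<lambda>i. qjoin Q (A i)) ` I \<Longrightarrow> qle Q a c"
  have "qle Q b c" if "i \<in> I" "b \<in> A i" for i b
  proof -
    have "qle Q (qjoin Q (A i)) c" using c that by auto
    then show ?thesis using qjoin_le_iff[OF assms[OF that(1)] c(1)] that by auto
  qed
  then show "qle Q (qjoin Q (\<Union>i\<in>I. A i)) c"
    using assms c by (intro qjoin_least) auto
qed

lemma mult_mono:
  assumes "qle Q a b" "a \<in> carrier Q" "b \<in> carrier Q" "c \<in> carrier Q"
  shows "qle Q (c \<otimes> a) (c \<otimes> b)"
proof -
  have "c \<otimes> b = qjoin Q {c \<otimes> a, c \<otimes> b}"
    using mult_qjoin[of c "{a, b}"] assms by (simp add: qjoin_insert_le)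
  then show ?thesis
    using qjoin_upper[of "c \<otimes> a" "{c \<otimes> a, c \<otimes> b}"] assms by simp
qed

text \<open>Distributivity is applied in the right factor, then by commutativity in the left one,
  and \<open>qjoin_UN\<close> flattens the join of joins. This is what makes the inverse of the
  transpose multiplicative.\<close>

lemma mult_qjoin_qjoin:
  assumes "A \<subseteq> carrier Q" "B \<subseteq> carrier Q"
  shows "qjoin Q A \<otimes> qjoin Q B = qjoin Q {a \<otimes> b |a b. a \<in> A \<and> b \<in> B}"
proof -
  have "qjoin Q A \<otimes> qjoin Q B = qjoin Q ((\<lambda>b. qjoin Q A \<otimes> b) ` B)"
    using assms by (simp add: mult_qjoin qjoin_closed)
  also have "(\<lambda>b. qjoin Q A \<otimes> b) ` B = (\<lambda>b. qjoin Q ((\<lambda>a. a \<otimes> b) ` A)) ` B"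
  proof (rule image_cong[OF refl])
    fix b assume "b \<in> B"
    then have b: "b \<in> carrier Q" using assms by auto
    have "qjoin Q A \<otimes> b = qjoin Q ((\<lambda>a. b \<otimes> a) ` A)"
      using assms b mult_qjoin[of b A] m_comm[of b "qjoin Q A"] by (simp add: qjoin_closed)
    also have "(\<lambda>a. b \<otimes> a) ` A = (\<lambda>a. a \<otimes> b) ` A"
      using assms b by (intro image_cong) (auto simp: m_comm)
    finally show "qjoin Q A \<otimes> b = qjoin Q ((\<lambda>a. a \<otimes> b) ` A)" .
  qed
  also have "qjoin Q \<dots> = qjoin Q (\<Union>b\<in>B. (\<lambda>a. a \<otimes> b) ` A)"
    using assms by (intro qjoin_UN[symmetric]) auto
  also have "(\<Union>b\<in>B. (\<lambda>a. a \<otimes> b) ` A) = {a \<otimes> b |a b. a \<in> A \<and> b \<in> B}"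
    by auto
  finally show ?thesis .
qed

end

section \<open>Negation as a residual of the dualizing element\<close>

context girard_quantale
begin

lemma qneg_closed: "qneg Q a \<in> carrier Q"
  unfolding qneg_def by (rule qjoin_closed) auto

text \<open>Distributivity moves multiplication by \<open>a\<close> inside the join that defines
  \<open>qneg Q a\<close>, so this join satisfies its own defining inequality and is the largest
  element that does.\<close>

lemma le_qneg_iff:
  assumes "a \<in> carrier Q" "c \<in> carrier Q"
  shows "qle Q c (qneg Q a) \<longleftrightarrow> qle Q (c \<otimes> a) (dualizer Q)"
proof
  let ?C = "{c \<in> carrier Q. qle Q (c \<otimes> a) (dualizer Q)}"
  have "a \<otimes> qneg Q a = qjoin Q ((\<lambda>c. a \<otimes> c) ` ?C)"
    unfolding qneg_def using assms by (intro mult_qjoin) auto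
  also have "qle Q \<dots> (dualizer Q)"
    using assms by (intro qjoin_least) (auto simp: dualizer_closed m_comm)
  finally have *: "qle Q (a \<otimes> qneg Q a) (dualizer Q)" .
  assume "qle Q c (qneg Q a)"
  then have "qle Q (a \<otimes> c) (a \<otimes> qneg Q a)"
    using assms by (simp add: mult_mono qneg_closed)
  then show "qle Q (c \<otimes> a) (dualizer Q)"
    using * assms qle_trans[of "a \<otimes> c" "a \<otimes> qneg Q a" "dualizer Q"]
    by (simp add: m_comm qneg_closed dualizer_closed)
next
  assume "qle Q (c \<otimes> a) (dualizer Q)"
  then show "qle Q c (qneg Q a)"
    unfolding qneg_def using assms by (intro qjoin_upper) auto
qed

end

section \<open>Homomorphisms of Girard quantales\<close>

lemma gq_hom_closed: "\<lbrakk>f \<in> gq_hom Q R; a \<in> carrier Q\<rbrakk> \<Longrightarrow> f a \<in> carrier R"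
  by (auto simp: gq_hom_def)

lemma gq_hom_qjoin:
  "\<lbrakk>f \<in> gq_hom Q R; A \<subseteq> carrier Q\<rbrakk> \<Longrightarrow> f (qjoin Q A) = qjoin R (f ` A)"
  by (auto simp: gq_hom_def)

lemma gq_hom_mult:
  "\<lbrakk>f \<in> gq_hom Q R; a \<in> carrier Q; b \<in> carrier Q\<rbrakk> \<Longrightarrow> f (a \<otimes>\<^bsub>Q\<^esub> b) = f a \<otimes>\<^bsub>R\<^esub> f b"
  by (auto simp: gq_hom_def)

lemma gq_hom_one: "f \<in> gq_hom Q R \<Longrightarrow> f \<one>\<^bsub>Q\<^esub> = \<one>\<^bsub>R\<^esub>"
  by (auto simp: gq_hom_def)

lemma gq_hom_dualizer: "f \<in> gq_hom Q R \<Longrightarrow> qle R (f (dualizer Q)) (dualizer R)"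
  by (auto simp: gq_hom_def)

lemma gq_hom_mono:
  assumes "comm_quantale Q" "comm_quantale R" "f \<in> gq_hom Q R"
    and "qle Q a b" "a \<in> carrier Q" "b \<in> carrier Q"
  shows "qle R (f a) (f b)"
proof -
  interpret Q: comm_quantale Q by fact
  interpret R: comm_quantale R by fact
  have "f b = qjoin R {f a, f b}"
    using gq_hom_qjoin[OF assms(3), of "{a, b}"] assms by (simp add: Q.qjoin_insert_le)
  then show ?thesis
    using R.qjoin_upper[of "f a" "{f a, f b}"] assms by (simp add: gq_hom_closed)
qed

text \<open>Monotonicity followed by the lax condition on dualizing elements. Membership in
  \<open>falsum\<close> is transported along \<open>f\<close> in this form.\<close>

lemma gq_hom_le_dualizer:
  assumes "girard_quantale Q" "girard_quantale R" "f \<in> gq_hom Q R"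
    and "qle Q a (dualizer Q)" "a \<in> carrier Q"
  shows "qle R (f a) (dualizer R)"
proof -
  interpret Q: girard_quantale Q by fact
  interpret R: girard_quantale R by fact
  have "qle R (f a) (f (dualizer Q))"
    using assms by (intro gq_hom_mono[OF Q.comm_quantale_axioms R.comm_quantale_axioms])
      (auto simp: Q.dualizer_closed)
  then show ?thesis
    using assms gq_hom_dualizer[OF assms(3)]
    by (meson R.qle_trans gq_hom_closed Q.dualizer_closed R.dualizer_closed)
qed

subsection \<open>Positions and their values\<close>

lemma positions_0: "0 \<in> positions S"
  by (simp add: positions_def)

lemma positions_add: "\<lbrakk>p \<in> positions S; q \<in> positions S\<rbrakk> \<Longrightarrow> p + q \<in> positions S"
  by (auto simp: positions_def)

lemma positions_set_add:
  "\<lbrakk>A \<subseteq> positions S; B \<subseteq> positions S\<rbrakk> \<Longrightarrow> A + B \<subseteq> positions S"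
  by (rule subsetI, erule set_plus_elim) (simp add: positions_add subsetD)

lemma positions_left: "x \<in> S \<Longrightarrow> ({#x#}, {#}) \<in> positions S"
  and positions_right: "x \<in> S \<Longrightarrow> ({#}, {#x#}) \<in> positions S"
  by (auto simp: positions_def)

text \<open>Positions form the free commutative monoid on the left and right singletons. The rule is
  used to show that two multiplicative functions of a position agree once they agree on these
  generators.\<close>

lemma positions_induct [consumes 1, case_names zero left right]:
  assumes "p \<in> positions S"
    and zero: "P 0"
    and left: "\<And>x p. \<lbrakk>x \<in> S; p \<in> positions S; P p\<rbrakk> \<Longrightarrow> P (({#x#}, {#}) + p)"
    and right: "\<And>x p. \<lbrakk>x \<in> S; p \<in> positions S; P p\<rbrakk> \<Longrightarrow> P (({#}, {#x#}) + p)"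
  shows "P p"
proof -
  have 1: "P (M, {#})" if "set_mset M \<subseteq> S" for M
    using that
  proof (induction M)
    case empty
    then show ?case using zero by (simp add: zero_prod_def)
  next
    case (add x M)
    then show ?case using left[of x "(M, {#})"] by (simp add: positions_def)
  qed
  have "P (M, N)" if "set_mset M \<subseteq> S" "set_mset N \<subseteq> S" for M N
    using that(2)
  proof (induction N)
    case empty
    then show ?case using 1 that by simp
  next
    case (add x N)
    then show ?case using right[of x "(M, N)"] that by (simp add: positions_def)
  qed
  then show ?thesis
    using assms(1) by (cases p) (simp add: positions_def)
qed

lemma pos_map_add: "pos_map f (p + q) = pos_map f p + pos_map f q"
  by (cases p; cases q) (simp add: pos_map_def)

lemma pos_map_0: "pos_map f 0 = 0"
  by (simp add: pos_map_def zero_prod_def)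

lemma pos_map_simps [simp]: "pos_map f (M, N) = (image_mset f M, image_mset f N)"
  by (simp add: pos_map_def)

lemma pos_map_set_add: "pos_map f ` (A + B) = pos_map f ` A + pos_map f ` B"
proof (intro subset_antisym subsetI)
  fix r assume "r \<in> pos_map f ` (A + B)"
  then obtain p q where "p \<in> A" "q \<in> B" "r = pos_map f (p + q)"
    by (elim set_plus_elim imageE) simp
  then show "r \<in> pos_map f ` A + pos_map f ` B"
    by (simp add: pos_map_add set_plus_intro)
next
  fix r assume "r \<in> pos_map f ` A + pos_map f ` B"
  then obtain p q where "p \<in> A" "q \<in> B" "r = pos_map f p + pos_map f q"
    by (elim set_plus_elim imageE) simp
  then show "r \<in> pos_map f ` (A + B)"
    by (simp add: set_plus_intro flip: pos_map_add)
qed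

lemma pos_map_closed:
  "\<lbrakk>f ` S \<subseteq> T; p \<in> positions S\<rbrakk> \<Longrightarrow> pos_map f p \<in> positions T"
  by (cases p) (auto simp: positions_def)

lemma pos_map_cong:
  "\<lbrakk>p \<in> positions S; \<And>x. x \<in> S \<Longrightarrow> f x = g x\<rbrakk> \<Longrightarrow> pos_map f p = pos_map g p"
  by (cases p) (auto simp: positions_def intro!: image_mset_cong)

lemma pos_map_ident: "\<lbrakk>p \<in> positions S; \<And>x. x \<in> S \<Longrightarrow> f x = x\<rbrakk> \<Longrightarrow> pos_map f p = p"
  using pos_map_cong[of p S f "\<lambda>x. x"] by (cases p) simp

lemma pos_map_compose:
  "p \<in> positions S \<Longrightarrow> pos_map (compose S g f) p = pos_map g (pos_map f p)"
  by (cases p) (auto simp: positions_def compose_def multiset.map_comp intro!: image_mset_cong)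

lemma image_pos_map_compose:
  "A \<subseteq> positions S \<Longrightarrow> pos_map (compose S g f) ` A = pos_map g ` pos_map f ` A"
  unfolding image_image by (intro image_cong refl pos_map_compose) (rule subsetD)

text \<open>The monoid homomorphism from positions over pairs to \<open>Q\<close> that sends the
  left singleton at (a, b) to a and the right singleton to b.\<close>

definition pos_val :: "('a, 'm) monoid_scheme \<Rightarrow> ('a \<times> 'a) position \<Rightarrow> 'a" where
  "pos_val Q p = mset_prod Q fst (fst p) \<otimes>\<^bsub>Q\<^esub> mset_prod Q snd (snd p)"

context comm_monoid
begin

text \<open>An element of count 0 contributes a unit factor. Enlarging the index set lets
  \<open>mset_prod_add\<close> multiply two products over the union of their supports.\<close>

lemma mset_prod_superset:
  assumes "finite A" "set_mset M \<subseteq> A" "\<And>x. x \<in> A \<Longrightarrow> h x \<in> carrier G"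
  shows "mset_prod G h M = (\<Otimes>x\<in>A. h x [^] count M x)"
  unfolding mset_prod_def using assms
  by (intro finprod_mono_neutral_cong_left) (auto simp: not_in_iff)

lemma mset_prod_closed:
  "\<lbrakk>\<And>x. x \<in># M \<Longrightarrow> h x \<in> carrier G\<rbrakk> \<Longrightarrow> mset_prod G h M \<in> carrier G"
  unfolding mset_prod_def by (intro finprod_closed) auto

lemma mset_prod_add:
  assumes "\<And>x. x \<in># M \<Longrightarrow> h x \<in> carrier G" "\<And>x. x \<in># N \<Longrightarrow> h x \<in> carrier G"
  shows "mset_prod G h (M + N) = mset_prod G h M \<otimes> mset_prod G h N"
proof -
  let ?A = "set_mset M \<union> set_mset N"
  have A: "h x \<in> carrier G" if "x \<in> ?A" for x using assms that by auto
  have "mset_prod G h (M + N) = (\<Otimes>x\<in>?A. h x [^] count M x \<otimes> h x [^] count N x)"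
  proof -
    have "mset_prod G h (M + N) = (\<Otimes>x\<in>?A. h x [^] count (M + N) x)"
      using A by (intro mset_prod_superset) auto
    also have "\<dots> = (\<Otimes>x\<in>?A. h x [^] count M x \<otimes> h x [^] count N x)"
      using A by (intro finprod_cong') (auto simp: nat_pow_mult)
    finally show ?thesis .
  qed
  also have "\<dots> = (\<Otimes>x\<in>?A. h x [^] count M x) \<otimes> (\<Otimes>x\<in>?A. h x [^] count N x)"
    using A by (intro finprod_multf) auto
  finally show ?thesis
    using mset_prod_superset[of ?A M h] mset_prod_superset[of ?A N h] A by simp
qed

lemma mset_prod_empty: "mset_prod G h {#} = \<one>"
  by (simp add: mset_prod_def)

lemma mset_prod_single: "h x \<in> carrier G \<Longrightarrow> mset_prod G h {#x#} = h x"
  by (simp add: mset_prod_def)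

lemma pos_val_closed: "p \<in> positions (carrier G \<times> carrier G) \<Longrightarrow> pos_val G p \<in> carrier G"
  unfolding pos_val_def positions_def by (auto intro!: m_closed mset_prod_closed)

lemma pos_val_add:
  assumes "p \<in> positions (carrier G \<times> carrier G)" "q \<in> positions (carrier G \<times> carrier G)"
  shows "pos_val G (p + q) = pos_val G p \<otimes> pos_val G q"
proof -
  have c: "mset_prod G fst (fst r) \<in> carrier G" "mset_prod G snd (snd r) \<in> carrier G"
    if "r \<in> positions (carrier G \<times> carrier G)" for r
    using that by (auto simp: positions_def intro!: mset_prod_closed)
  have "mset_prod G fst (fst p + fst q) = mset_prod G fst (fst p) \<otimes> mset_prod G fst (fst q)"
    "mset_prod G snd (snd p + snd q) = mset_prod G snd (snd p) \<otimes> mset_prod G snd (snd q)"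
    using assms by (auto simp: positions_def intro!: mset_prod_add)
  then show ?thesis
    using c[OF assms(1)] c[OF assms(2)] by (simp add: pos_val_def m_ac)
qed

lemma pos_val_0: "pos_val G 0 = \<one>"
  by (simp add: pos_val_def mset_prod_empty zero_prod_def)

lemma pos_val_left: "a \<in> carrier G \<Longrightarrow> pos_val G ({#(a, b)#}, {#}) = a"
  and pos_val_right: "b \<in> carrier G \<Longrightarrow> pos_val G ({#}, {#(a, b)#}) = b"
  by (simp_all add: pos_val_def mset_prod_empty mset_prod_single)

end

text \<open>Both sides are multiplicative in \<open>p\<close>, since \<open>f\<close> preserves
  products and the unit, and they agree on left and right singletons.\<close>

lemma gq_hom_pos_val:
  assumes "girard_quantale Q" "girard_quantale R" "f \<in> gq_hom Q R"
    and "p \<in> positions (carrier Q \<times> carrier Q)"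
  shows "pos_val R (pos_map (map_prod f f) p) = f (pos_val Q p)"
proof -
  interpret Q: girard_quantale Q by fact
  interpret R: girard_quantale R by fact
  have img: "map_prod f f ` (carrier Q \<times> carrier Q) \<subseteq> carrier R \<times> carrier R"
    using gq_hom_closed[OF assms(3)] by auto
  note closed = pos_map_closed[OF img]
  from assms(4) show ?thesis
  proof (induction rule: positions_induct)
    case zero
    show ?case
      using gq_hom_one[OF assms(3)] by (simp add: pos_map_0 Q.pos_val_0 R.pos_val_0)
  next
    case (left x p)
    obtain a b where x: "x = (a, b)" "a \<in> carrier Q" "b \<in> carrier Q" using left by auto
    have "pos_val R (pos_map (map_prod f f) (({#x#}, {#}) + p)) =
        f a \<otimes>\<^bsub>R\<^esub> pos_val R (pos_map (map_prod f f) p)"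
      unfolding pos_map_add using closed[OF positions_left[OF left(1)]] closed[OF left(2)] x
      by (simp add: R.pos_val_add R.pos_val_left gq_hom_closed[OF assms(3)])
    also have "\<dots> = f (pos_val Q (({#x#}, {#}) + p))"
      using left x positions_left[OF left(1)]
      by (simp add: Q.pos_val_add Q.pos_val_left Q.pos_val_closed gq_hom_mult[OF assms(3)]
        del: add_Pair)
    finally show ?case .
  next
    case (right x p)
    obtain a b where x: "x = (a, b)" "a \<in> carrier Q" "b \<in> carrier Q" using right by auto
    have "pos_val R (pos_map (map_prod f f) (({#}, {#x#}) + p)) =
        f b \<otimes>\<^bsub>R\<^esub> pos_val R (pos_map (map_prod f f) p)"
      unfolding pos_map_add using closed[OF positions_right[OF right(1)]] closed[OF right(2)] x
      by (simp add: R.pos_val_add R.pos_val_right gq_hom_closed[OF assms(3)])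
    also have "\<dots> = f (pos_val Q (({#}, {#x#}) + p))"
      using right x positions_right[OF right(1)]
      by (simp add: Q.pos_val_add Q.pos_val_right Q.pos_val_closed gq_hom_mult[OF assms(3)]
        del: add_Pair)
    finally show ?case .
  qed
qed

subsection \<open>Orthogonality\<close>

lemma perp_subset: "perp X A \<subseteq> positions (carrier X)"
  by (auto simp: perp_def)

lemma perp_antimono: "A \<subseteq> B \<Longrightarrow> perp X B \<subseteq> perp X A"
  by (auto simp: perp_def)

lemma subset_biperp: "A \<subseteq> positions (carrier X) \<Longrightarrow> A \<subseteq> biperp X A"
  by (auto simp: perp_def add.commute)

lemma perp_biperp: "A \<subseteq> positions (carrier X) \<Longrightarrow> perp X (biperp X A) = perp X A"
  by (intro subset_antisym perp_antimono subset_biperp perp_subset)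

lemma biperp_least:
  assumes "A \<subseteq> B" "biperp X B = B"
  shows "biperp X A \<subseteq> B"
  using perp_antimono[OF perp_antimono[OF assms(1), of X], of X] assms(2) by simp

text \<open>The index set must be inhabited: an empty intersection is the whole type, whereas
  \<open>perp X {}\<close> consists of the positions of the frame.\<close>

lemma perp_UN: "I \<noteq> {} \<Longrightarrow> perp X (\<Union>i\<in>I. A i) = (\<Inter>i\<in>I. perp X (A i))"
  by (auto simp: perp_def)

text \<open>Members of a union may be closed beforehand, because a set and its closure have the same
  orthogonal. Nested joins of closed sets are flattened in this way.\<close>

lemma perp_UN_biperp:
  assumes "\<And>i. i \<in> I \<Longrightarrow> A i \<subseteq> positions (carrier X)"
  shows "perp X (\<Union>i\<in>I. biperp X (A i)) = perp X (\<Union>i\<in>I. A i)"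
  using assms by (cases "I = {}") (simp_all add: perp_UN perp_biperp)

text \<open>Residuation: moving \<open>B\<close> to the other side leaves a condition that mentions
  \<open>A\<close> only through \<open>perp X A\<close>, so \<open>A\<close> can be exchanged for
  its closure.\<close>

lemma mem_perp_set_add_iff:
  assumes "B \<subseteq> positions (carrier X)"
  shows "p \<in> perp X (A + B) \<longleftrightarrow> p \<in> positions (carrier X) \<and> (\<forall>b \<in> B. b + p \<in> perp X A)"
proof -
  have "(\<forall>r \<in> A + B. r + p \<in> falsum X) \<longleftrightarrow> (\<forall>b \<in> B. \<forall>a \<in> A. a + (b + p) \<in> falsum X)"
    unfolding add.assoc[symmetric] by (blast intro: set_plus_intro elim: set_plus_elim)
  moreover have "b + p \<in> positions (carrier X)" if "b \<in> B" "p \<in> positions (carrier X)" for b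
    using assms that by (simp add: positions_add subsetD)
  ultimately show ?thesis
    unfolding perp_def by blast
qed

text \<open>The nucleus property of double orthogonality. It carries the monoid laws and
  distributivity from sets of positions over to closed sets.\<close>

lemma perp_set_add_biperp_left:
  assumes "A \<subseteq> positions (carrier X)" "B \<subseteq> positions (carrier X)"
  shows "perp X (biperp X A + B) = perp X (A + B)"
  using assms by (auto simp: mem_perp_set_add_iff perp_biperp)

lemma perp_set_add_biperp_right:
  assumes "A \<subseteq> positions (carrier X)" "B \<subseteq> positions (carrier X)"
  shows "perp X (A + biperp X B) = perp X (A + B)"
  using perp_set_add_biperp_left[OF assms(2,1)] by (simp add: add.commute)

lemma set_add_subset_falsum_iff:
  assumes "B \<subseteq> positions (carrier X)"
  shows "A + B \<subseteq> falsum X \<longleftrightarrow> B \<subseteq> perp X A"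
  unfolding perp_def using assms by (blast intro: set_plus_intro elim!: set_plus_elim)

text \<open>Exhibits \<open>falsum X\<close> as an orthogonal, which is why it is closed and can
  serve as dualizing element.\<close>

lemma perp_zero: "implication_frame X \<Longrightarrow> perp X {0} = falsum X"
  by (auto simp: perp_def implication_frame_def)

lemma if_hom_closed: "\<lbrakk>f \<in> if_hom X Y; x \<in> carrier X\<rbrakk> \<Longrightarrow> f x \<in> carrier Y"
  by (auto simp: if_hom_def)

lemma if_hom_pos_map_closed:
  "\<lbrakk>f \<in> if_hom X Y; A \<subseteq> positions (carrier X)\<rbrakk> \<Longrightarrow> pos_map f ` A \<subseteq> positions (carrier Y)"
  by (rule image_subsetI, rule pos_map_closed[of f "carrier X"]) (blast dest: if_hom_closed)+

lemma if_hom_falsum: "f \<in> if_hom X Y \<Longrightarrow> pos_map f ` falsum X \<subseteq> falsum Y"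
  by (simp add: if_hom_def)

lemma if_hom_perp_mono:
  "\<lbrakk>f \<in> if_hom X Y; A \<subseteq> positions (carrier X); B \<subseteq> positions (carrier X);
    perp X A \<subseteq> perp X B\<rbrakk> \<Longrightarrow> perp Y (pos_map f ` A) \<subseteq> perp Y (pos_map f ` B)"
  by (simp add: if_hom_def)

lemma if_hom_perp_cong:
  "\<lbrakk>f \<in> if_hom X Y; A \<subseteq> positions (carrier X); B \<subseteq> positions (carrier X);
    perp X A = perp X B\<rbrakk> \<Longrightarrow> perp Y (pos_map f ` A) = perp Y (pos_map f ` B)"
  by (simp add: if_hom_perp_mono subset_antisym)

text \<open>Continuity in the form used most: passing to the closure before taking images changes
  nothing up to orthogonality.\<close>

lemma if_hom_perp_biperp:
  "\<lbrakk>f \<in> if_hom X Y; A \<subseteq> positions (carrier X)\<rbrakk> \<Longrightarrow>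
    perp Y (pos_map f ` biperp X A) = perp Y (pos_map f ` A)"
  by (rule if_hom_perp_cong) (auto simp: perp_biperp perp_subset)

subsection \<open>The quantale of closed sets of positions\<close>

text \<open>Identifies the defining set of sums with the Minkowski sum, for which associativity and
  commutativity are available.\<close>

lemma set_add_Collect: "{a + b |a b. a \<in> A \<and> b \<in> B} = A + B"
  by (blast intro: set_plus_intro elim: set_plus_elim)

lemma F_obj_simps [simp]:
  "carrier (F_obj X) = {A. A \<subseteq> positions (carrier X) \<and> biperp X A = A}"
  "A \<otimes>\<^bsub>F_obj X\<^esub> B = biperp X (A + B)"
  "\<one>\<^bsub>F_obj X\<^esub> = biperp X {0}"
  "qle (F_obj X) = (\<subseteq>)"
  "dualizer (F_obj X) = falsum X"
  by (simp_all add: F_obj_def set_add_Collect del: split_paired_Ex)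

lemma perp_in_F_obj: "A \<subseteq> positions (carrier X) \<Longrightarrow> perp X A \<in> carrier (F_obj X)"
  by (simp add: perp_biperp perp_subset)

lemma biperp_in_F_obj: "biperp X A \<in> carrier (F_obj X)"
  by (rule perp_in_F_obj) (rule perp_subset)

section \<open>Completeness of the lattice of closed sets\<close>

lemma qord_F_obj_simps:
  "carrier (qord (F_obj X)) = carrier (F_obj X)" "le (qord (F_obj X)) = (\<subseteq>)"
  by (simp_all add: qord_def)

lemma F_obj_partial_order: "partial_order (qord (F_obj X))"
  by standard (auto simp: qord_def)

lemma F_obj_join:
  assumes "A \<subseteq> carrier (F_obj X)"
  shows "least (qord (F_obj X)) (biperp X (\<Union>A)) (Upper (qord (F_obj X)) A)"
proof -
  have "\<Union>A \<subseteq> positions (carrier X)" using assms by auto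
  then have "B \<subseteq> biperp X (\<Union>A)" if "B \<in> A" for B
    using subset_biperp that by blast
  moreover have "biperp X (\<Union>A) \<subseteq> C"
    if "C \<in> carrier (F_obj X)" "\<And>B. B \<in> A \<Longrightarrow> B \<subseteq> C" for C
    using that by (intro biperp_least) auto
  ultimately show ?thesis
    unfolding least_def Upper_def qord_F_obj_simps
    using assms biperp_in_F_obj[of X "\<Union>A"] by blast
qed

text \<open>The meet is the intersection, written as an orthogonal: closedness is then immediate,
  and the empty family yields all positions of the frame, the top element.\<close>

lemma F_obj_meet:
  assumes "A \<subseteq> carrier (F_obj X)"
  shows "greatest (qord (F_obj X)) (perp X (\<Union>B\<in>A. perp X B)) (Lower (qord (F_obj X)) A)"
proof -
  let ?M = "perp X (\<Union>B\<in>A. perp X B)"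
  have sub: "(\<Union>B\<in>A. perp X B) \<subseteq> positions (carrier X)" using perp_subset by auto
  have "?M \<subseteq> B" if "B \<in> A" for B
  proof -
    have "?M \<subseteq> biperp X B" using that by (intro perp_antimono) auto
    then show ?thesis using assms that by auto
  qed
  moreover have "C \<subseteq> ?M"
    if C: "C \<in> carrier (F_obj X)" "\<And>B. B \<in> A \<Longrightarrow> C \<subseteq> B" for C
  proof -
    have "(\<Union>B\<in>A. perp X B) \<subseteq> perp X C" by (intro UN_least perp_antimono C(2))
    then have "biperp X C \<subseteq> ?M" by (rule perp_antimono)
    then show ?thesis using C(1) by simp
  qed
  ultimately show ?thesis
    unfolding greatest_def Lower_def qord_F_obj_simps
    using assms perp_in_F_obj[OF sub] by blast
qed

lemma F_obj_complete_lattice: "complete_lattice (qord (F_obj X))"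
proof (intro complete_lattice.intro complete_lattice_axioms.intro)
  fix A assume "A \<subseteq> carrier (qord (F_obj X))"
  then have A: "A \<subseteq> carrier (F_obj X)" by (simp only: qord_F_obj_simps)
  show "\<exists>S. least (qord (F_obj X)) S (Upper (qord (F_obj X)) A)"
    using F_obj_join[OF A] by (rule exI)
  show "\<exists>S. greatest (qord (F_obj X)) S (Lower (qord (F_obj X)) A)"
    using F_obj_meet[OF A] by (rule exI)
qed (rule F_obj_partial_order)

lemma F_obj_qjoin:
  assumes "A \<subseteq> carrier (F_obj X)"
  shows "qjoin (F_obj X) A = biperp X (\<Union>A)"
proof -
  interpret complete_lattice "qord (F_obj X)" by (rule F_obj_complete_lattice)
  have "A \<subseteq> carrier (qord (F_obj X))" using assms by (simp only: qord_F_obj_simps)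
  then have "least (qord (F_obj X)) (qjoin (F_obj X) A) (Upper (qord (F_obj X)) A)"
    unfolding qjoin_def by (rule sup_lub)
  then show ?thesis
    using F_obj_join[OF assms] by (rule least_unique)
qed

section \<open>Multiplication and negation of closed sets\<close>

lemma F_obj_comm_monoid: "comm_monoid (F_obj X)"
proof (rule comm_monoidI)
  fix A B C
  assume ABC: "A \<in> carrier (F_obj X)" "B \<in> carrier (F_obj X)" "C \<in> carrier (F_obj X)"
  have sub: "A \<subseteq> positions (carrier X)" "B \<subseteq> positions (carrier X)" "C \<subseteq> positions (carrier X)"
    using ABC by auto
  \<comment> \<open>Inner closures are invisible to \<open>perp\<close>, so both bracketings have
    the orthogonal of the plain sum of the three sets.\<close>
  have "perp X (biperp X (A + B) + C) = perp X (A + biperp X (B + C))"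
    using sub by (simp add: perp_set_add_biperp_left perp_set_add_biperp_right
        positions_set_add add.assoc)
  then show "(A \<otimes>\<^bsub>F_obj X\<^esub> B) \<otimes>\<^bsub>F_obj X\<^esub> C = A \<otimes>\<^bsub>F_obj X\<^esub> (B \<otimes>\<^bsub>F_obj X\<^esub> C)"
    by simp
next
  fix A assume A: "A \<in> carrier (F_obj X)"
  have "perp X (biperp X {0} + A) = perp X ({0} + A)"
    using A by (intro perp_set_add_biperp_left) (auto simp: positions_0)
  then show "\<one>\<^bsub>F_obj X\<^esub> \<otimes>\<^bsub>F_obj X\<^esub> A = A"
    using A by (simp add: set_plus_def)
next
  fix A B
  show "A \<otimes>\<^bsub>F_obj X\<^esub> B = B \<otimes>\<^bsub>F_obj X\<^esub> A" by (simp add: add.commute)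
  show "A \<otimes>\<^bsub>F_obj X\<^esub> B \<in> carrier (F_obj X)" using biperp_in_F_obj by simp
qed (use biperp_in_F_obj in simp)

lemma F_obj_comm_quantale: "comm_quantale (F_obj X)"
proof -
  interpret comm_monoid "F_obj X" by (rule F_obj_comm_monoid)
  show ?thesis
  proof (intro comm_quantale.intro comm_quantale_axioms.intro)
    fix A \<B> assume A: "A \<in> carrier (F_obj X)" and \<B>: "\<B> \<subseteq> carrier (F_obj X)"
    have sub: "A \<subseteq> positions (carrier X)" "\<Union>\<B> \<subseteq> positions (carrier X)"
      "\<And>B. B \<in> \<B> \<Longrightarrow> B \<subseteq> positions (carrier X)"
      using A \<B> by auto
    \<comment> \<open>The computation takes place one \<open>perp\<close> below the claim, where
      closures can be inserted and removed; applying \<open>perp\<close> once more gives the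
      equation of closed sets.\<close>
    have "perp X (A + biperp X (\<Union>\<B>)) = perp X (A + \<Union>\<B>)"
      using sub by (simp add: perp_set_add_biperp_right)
    also have "A + \<Union>\<B> = (\<Union>B\<in>\<B>. A + B)"
      by (auto simp: set_plus_def)
    also have "perp X \<dots> = perp X (\<Union>B\<in>\<B>. biperp X (A + B))"
      using sub by (intro perp_UN_biperp[symmetric]) (auto simp: positions_set_add)
    finally have "A \<otimes>\<^bsub>F_obj X\<^esub> biperp X (\<Union>\<B>) = biperp X (\<Union>B\<in>\<B>. A \<otimes>\<^bsub>F_obj X\<^esub> B)"
      by simp
    moreover have "(\<lambda>B. A \<otimes>\<^bsub>F_obj X\<^esub> B) ` \<B> \<subseteq> carrier (F_obj X)"
      by (intro image_subsetI m_closed A subsetD[OF \<B>])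
    ultimately show "A \<otimes>\<^bsub>F_obj X\<^esub> qjoin (F_obj X) \<B> =
        qjoin (F_obj X) ((\<lambda>B. A \<otimes>\<^bsub>F_obj X\<^esub> B) ` \<B>)"
      using \<B> by (simp only: F_obj_qjoin)
  next
    show "complete_lattice (qord (F_obj X))" by (rule F_obj_complete_lattice)
  qed (rule F_obj_comm_monoid)
qed

lemma falsum_in_F_obj: "implication_frame X \<Longrightarrow> falsum X \<in> carrier (F_obj X)"
  using perp_in_F_obj[of "{0}" X] by (simp add: perp_zero positions_0)

text \<open>The orthogonal of \<open>A\<close> belongs to the family whose join is the negation and
  contains every other member, so the join is attained. Involutivity of negation then becomes
  closedness.\<close>

lemma F_obj_qneg:
  assumes "implication_frame X" "A \<in> carrier (F_obj X)"
  shows "qneg (F_obj X) A = perp X A"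
proof -
  let ?C = "{C \<in> carrier (F_obj X). qle (F_obj X) (C \<otimes>\<^bsub>F_obj X\<^esub> A) (dualizer (F_obj X))}"
  have A: "A \<subseteq> positions (carrier X)" using assms by simp
  have "C \<subseteq> perp X A" if C: "C \<in> ?C" for C
  proof -
    have sub: "C \<subseteq> positions (carrier X)" using C by simp
    have "C + A \<subseteq> biperp X (C + A)" using sub A by (intro subset_biperp positions_set_add)
    also have "\<dots> \<subseteq> falsum X" using C by simp
    finally show ?thesis
      using set_add_subset_falsum_iff[OF sub, of A] by (simp add: add.commute)
  qed
  moreover have "perp X A \<in> ?C"
  proof -
    have "perp X A + A \<subseteq> falsum X"
      using set_add_subset_falsum_iff[OF perp_subset, of A X A] by (simp add: add.commute)
    then have "biperp X (perp X A + A) \<subseteq> falsum X"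
      using falsum_in_F_obj[OF assms(1)] by (intro biperp_least) auto
    then show ?thesis
      using perp_in_F_obj[OF A] by simp
  qed
  ultimately have "\<Union>?C = perp X A"
    by (intro subset_antisym Union_least Union_upper)
  moreover have "?C \<subseteq> carrier (F_obj X)" by (rule Collect_restrict)
  ultimately show ?thesis
    unfolding qneg_def using perp_biperp[OF A] by (simp only: F_obj_qjoin)
qed

lemma F_obj_girard_quantale:
  assumes "implication_frame X"
  shows "girard_quantale (F_obj X)"
proof -
  interpret comm_quantale "F_obj X" by (rule F_obj_comm_quantale)
  show ?thesis
  proof unfold_locales
    show "dualizer (F_obj X) \<in> carrier (F_obj X)" using falsum_in_F_obj[OF assms] by simp
  next
    fix A assume A: "A \<in> carrier (F_obj X)"
    then have "perp X A \<in> carrier (F_obj X)" by (intro perp_in_F_obj) auto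
    then show "qneg (F_obj X) (qneg (F_obj X) A) = A"
      using assms A by (simp only: F_obj_qneg) simp
  qed
qed

section \<open>Action of the left adjoint on morphisms\<close>

lemma F_map_apply:
  "A \<in> carrier (F_obj X) \<Longrightarrow> F_map X Y f A = biperp Y (pos_map f ` A)"
  by (simp add: F_map_def)

text \<open>By continuity the image of a closed set can be computed from any set that generates it.
  Preservation of joins, products, unit and composition all rest on this.\<close>

lemma F_map_biperp:
  "\<lbrakk>f \<in> if_hom X Y; A \<subseteq> positions (carrier X)\<rbrakk> \<Longrightarrow>
    F_map X Y f (biperp X A) = biperp Y (pos_map f ` A)"
  by (simp only: F_map_apply biperp_in_F_obj if_hom_perp_biperp)

lemma F_map_in_gq_hom:
  assumes X: "implication_frame X" and Y: "implication_frame Y" and f: "f \<in> if_hom X Y"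
  shows "F_map X Y f \<in> gq_hom (F_obj X) (F_obj Y)"
proof -
  note sub = if_hom_pos_map_closed[OF f]
  have "F_map X Y f \<in> carrier (F_obj X) \<rightarrow>\<^sub>E carrier (F_obj Y)"
    unfolding F_map_def restrict_PiE_iff by (intro ballI biperp_in_F_obj)
  moreover have "F_map X Y f (qjoin (F_obj X) \<A>) = qjoin (F_obj Y) (F_map X Y f ` \<A>)"
    if \<A>: "\<A> \<subseteq> carrier (F_obj X)" for \<A>
  proof -
    have s: "\<And>A. A \<in> \<A> \<Longrightarrow> A \<subseteq> positions (carrier X)" using \<A> by auto
    have "F_map X Y f (qjoin (F_obj X) \<A>) = biperp Y (pos_map f ` \<Union>\<A>)"
      using \<A> s f by (simp only: F_obj_qjoin F_map_biperp Union_least)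
    also have "pos_map f ` \<Union>\<A> = (\<Union>A\<in>\<A>. pos_map f ` A)" by auto
    also have "perp Y \<dots> = perp Y (\<Union>A\<in>\<A>. biperp Y (pos_map f ` A))"
      using s sub by (intro perp_UN_biperp[symmetric]) auto
    also have "(\<Union>A\<in>\<A>. biperp Y (pos_map f ` A)) = \<Union>(F_map X Y f ` \<A>)"
      using \<A> by (intro SUP_cong[OF refl]) (auto simp: F_map_def)
    also have "biperp Y \<dots> = qjoin (F_obj Y) (F_map X Y f ` \<A>)"
    proof (rule F_obj_qjoin[symmetric])
      show "F_map X Y f ` \<A> \<subseteq> carrier (F_obj Y)"
        using \<A> by (intro image_subsetI) (simp only: F_map_apply subsetD biperp_in_F_obj)
    qed
    finally show ?thesis .
  qed
  moreover have "F_map X Y f (A \<otimes>\<^bsub>F_obj X\<^esub> B) = F_map X Y f A \<otimes>\<^bsub>F_obj Y\<^esub> F_map X Y f B"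
    if AB: "A \<in> carrier (F_obj X)" "B \<in> carrier (F_obj X)" for A B
  proof -
    have s: "A \<subseteq> positions (carrier X)" "B \<subseteq> positions (carrier X)" using AB by auto
    have "F_map X Y f (A \<otimes>\<^bsub>F_obj X\<^esub> B) = biperp Y (pos_map f ` A + pos_map f ` B)"
      using f s by (simp only: F_obj_simps F_map_biperp positions_set_add pos_map_set_add)
    also have "\<dots> = biperp Y (biperp Y (pos_map f ` A) + biperp Y (pos_map f ` B))"
      using s sub by (simp add: perp_set_add_biperp_left perp_set_add_biperp_right perp_subset)
    finally show ?thesis using AB by (simp only: F_map_apply F_obj_simps(2))
  qed
  moreover have "F_map X Y f \<one>\<^bsub>F_obj X\<^esub> = \<one>\<^bsub>F_obj Y\<^esub>"
    using F_map_biperp[OF f, of "{0}"] by (simp add: positions_0 pos_map_0)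
  moreover have "F_map X Y f (falsum X) \<subseteq> falsum Y"
    using falsum_in_F_obj[OF X] falsum_in_F_obj[OF Y] if_hom_falsum[OF f]
    by (simp only: F_map_apply) (simp add: biperp_least)
  ultimately show ?thesis
    by (simp add: gq_hom_def del: F_obj_simps(1-3))
qed

lemma F_map_ident:
  "F_map X X (\<lambda>x \<in> carrier X. x) = (\<lambda>A \<in> carrier (F_obj X). A)"
proof (unfold F_map_def, rule restrict_ext)
  fix A assume A: "A \<in> carrier (F_obj X)"
  then have "pos_map (\<lambda>x \<in> carrier X. x) ` A = id ` A"
    by (intro image_cong[OF refl]) (auto intro!: pos_map_ident[of _ "carrier X"])
  then show "biperp X (pos_map (\<lambda>x \<in> carrier X. x) ` A) = A"
    using A by simp
qed

lemma F_map_compose: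
  assumes f: "f \<in> if_hom X Y" and g: "g \<in> if_hom Y Z"
  shows "F_map X Z (compose (carrier X) g f) =
    compose (carrier (F_obj X)) (F_map Y Z g) (F_map X Y f)"
  unfolding F_map_def[of X Z] compose_def[of "carrier (F_obj X)"]
proof (rule restrict_ext)
  fix A assume A: "A \<in> carrier (F_obj X)"
  then have s: "A \<subseteq> positions (carrier X)" by simp
  have "F_map Y Z g (F_map X Y f A) = biperp Z (pos_map g ` pos_map f ` A)"
    using A F_map_biperp[OF g if_hom_pos_map_closed[OF f s]] by (simp only: F_map_apply)
  then show "biperp Z (pos_map (compose (carrier X) g f) ` A) = F_map Y Z g (F_map X Y f A)"
    using s by (simp only: image_pos_map_compose)
qed

subsection \<open>The reflexive frame of a quantale\<close>

lemma carrier_U_obj: "carrier (U_obj Q) = carrier Q \<times> carrier Q"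
  by (simp add: U_obj_def)

lemma falsum_U_obj:
  "falsum (U_obj Q) = {p \<in> positions (carrier Q \<times> carrier Q). qle Q (pos_val Q p) (dualizer Q)}"
  by (auto simp: U_obj_def pos_val_def)

lemma falsum_Upm_obj:
  "falsum (Upm_obj Q) =
    {p \<in> positions (carrier (Upm_obj Q)). qle Q (pos_val Q p) (dualizer Q)}"
proof -
  have "reflexive_points (U_obj Q) \<subseteq> carrier Q \<times> carrier Q"
    by (auto simp: reflexive_points_def carrier_U_obj)
  then show ?thesis
    by (auto simp: Upm_obj_def frame_restrict_def falsum_U_obj positions_def)
qed

lemma carrier_Upm_obj_subset: "carrier (Upm_obj Q) \<subseteq> carrier Q \<times> carrier Q"
  by (auto simp: Upm_obj_def frame_restrict_def reflexive_points_def carrier_U_obj)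

lemma positions_Upm_obj:
  "p \<in> positions (carrier (Upm_obj Q)) \<Longrightarrow> p \<in> positions (carrier Q \<times> carrier Q)"
  using carrier_Upm_obj_subset[of Q] by (auto simp: positions_def)

lemma Upm_obj_reflexive_frame: "reflexive_frame (Upm_obj Q)"
  by (auto simp: reflexive_frame_def implication_frame_def Upm_obj_def frame_restrict_def
      reflexive_points_def positions_def)

section \<open>Orthogonality expressed through values\<close>

context
  fixes Q :: "'a girard"
  assumes Q: "girard_quantale Q"
begin

interpretation Q: girard_quantale Q by (rule Q)

lemma mem_carrier_Upm_obj:
  "(a, b) \<in> carrier (Upm_obj Q) \<longleftrightarrow>
    a \<in> carrier Q \<and> b \<in> carrier Q \<and> qle Q (a \<otimes>\<^bsub>Q\<^esub> b) (dualizer Q)"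
  by (auto simp: Upm_obj_def frame_restrict_def reflexive_points_def carrier_U_obj falsum_U_obj
      positions_def pos_val_def Q.mset_prod_single)

lemma pos_val_Upm_subset:
  "A \<subseteq> positions (carrier (Upm_obj Q)) \<Longrightarrow> pos_val Q ` A \<subseteq> carrier Q"
  using positions_Upm_obj Q.pos_val_closed by blast

text \<open>The pair \<open>\<langle>a, \<bottom>\<rangle>\<close> with \<open>\<bottom>\<close> the least element is reflexive, so restricting to
  reflexive elements loses no values.\<close>

lemma ex_pos_val:
  assumes "a \<in> carrier Q"
  obtains p where "p \<in> positions (carrier (Upm_obj Q))" "pos_val Q p = a"
proof
  \<comment> \<open>Distributivity over the empty join makes the least element absorbing.\<close>
  have "a \<otimes>\<^bsub>Q\<^esub> qjoin Q {} = qjoin Q {}"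
    using Q.mult_qjoin[OF assms, of "{}"] by simp
  then have "(a, qjoin Q {}) \<in> carrier (Upm_obj Q)"
    using assms Q.qjoin_closed[of "{}"] Q.qjoin_least[of "{}"]
    by (simp add: mem_carrier_Upm_obj Q.dualizer_closed)
  then show "({#(a, qjoin Q {})#}, {#}) \<in> positions (carrier (Upm_obj Q))"
    by (rule positions_left)
  show "pos_val Q ({#(a, qjoin Q {})#}, {#}) = a"
    using assms by (rule Q.pos_val_left)
qed

text \<open>Since the value of a sum is a product, orthogonality to \<open>A\<close> is a family of
  inequalities; distributivity merges them into one inequality about the join of the values of
  \<open>A\<close>.\<close>

lemma mem_perp_Upm_iff:
  assumes "A \<subseteq> positions (carrier (Upm_obj Q))"
  shows "p \<in> perp (Upm_obj Q) A \<longleftrightarrow> p \<in> positions (carrier (Upm_obj Q)) \<and>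
    qle Q (pos_val Q p \<otimes>\<^bsub>Q\<^esub> qjoin Q (pos_val Q ` A)) (dualizer Q)"
proof (cases "p \<in> positions (carrier (Upm_obj Q))")
  case True
  note p = positions_Upm_obj[OF True]
  have vA: "pos_val Q ` A \<subseteq> carrier Q" using assms by (rule pos_val_Upm_subset)
  have vp: "pos_val Q p \<in> carrier Q" using p by (rule Q.pos_val_closed)
  have *: "q + p \<in> falsum (Upm_obj Q) \<longleftrightarrow> qle Q (pos_val Q p \<otimes>\<^bsub>Q\<^esub> pos_val Q q) (dualizer Q)"
    if "q \<in> A" for q
  proof -
    have q: "q \<in> positions (carrier (Upm_obj Q))" using that assms by auto
    then show ?thesis
      using True p positions_Upm_obj[OF q]
      by (simp add: falsum_Upm_obj positions_add add.commute[of q] Q.pos_val_add)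
  qed
  have "qle Q (pos_val Q p \<otimes>\<^bsub>Q\<^esub> qjoin Q (pos_val Q ` A)) (dualizer Q) \<longleftrightarrow>
      (\<forall>q\<in>A. qle Q (pos_val Q p \<otimes>\<^bsub>Q\<^esub> pos_val Q q) (dualizer Q))"
    unfolding Q.mult_qjoin[OF vp vA]
    using vA vp by (subst Q.qjoin_le_iff) (auto simp: Q.dualizer_closed)
  then show ?thesis
    using True * by (auto simp: perp_def)
qed (auto simp: perp_def)

text \<open>Turns continuity of a map into \<open>Upm_obj Q\<close> into an inequality of joins. One
  direction is monotonicity of multiplication; the other needs one test position and the
  involutivity of negation.\<close>

lemma perp_Upm_subset_iff:
  assumes A: "A \<subseteq> positions (carrier (Upm_obj Q))" and B: "B \<subseteq> positions (carrier (Upm_obj Q))"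
  shows "perp (Upm_obj Q) A \<subseteq> perp (Upm_obj Q) B \<longleftrightarrow>
    qle Q (qjoin Q (pos_val Q ` B)) (qjoin Q (pos_val Q ` A))"
proof
  let ?a = "qjoin Q (pos_val Q ` A)" and ?b = "qjoin Q (pos_val Q ` B)"
  have a: "?a \<in> carrier Q" and b: "?b \<in> carrier Q"
    using A B by (auto intro!: Q.qjoin_closed dest: pos_val_Upm_subset)
  {
    assume le: "perp (Upm_obj Q) A \<subseteq> perp (Upm_obj Q) B"
    \<comment> \<open>The test position has the negation of \<open>?a\<close> as its value. It is
      orthogonal to \<open>A\<close>, and its orthogonality to \<open>B\<close> says that
      \<open>?b\<close> is below the double negation of \<open>?a\<close>.\<close>
    obtain p where p: "p \<in> positions (carrier (Upm_obj Q))" "pos_val Q p = qneg Q ?a"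
      using Q.qneg_closed ex_pos_val by blast
    have "p \<in> perp (Upm_obj Q) A"
      using p A a Q.le_qneg_iff[of ?a "qneg Q ?a"]
      by (simp add: mem_perp_Upm_iff Q.qneg_closed Q.qle_refl)
    then have "p \<in> perp (Upm_obj Q) B" using le by auto
    then have "qle Q (qneg Q ?a \<otimes>\<^bsub>Q\<^esub> ?b) (dualizer Q)"
      using p B by (simp add: mem_perp_Upm_iff)
    then have "qle Q ?b (qneg Q (qneg Q ?a))"
      using a b by (simp add: Q.le_qneg_iff Q.qneg_closed Q.m_comm)
    then show "qle Q ?b ?a" using a by (simp add: Q.qneg_qneg)
  next
    assume le: "qle Q ?b ?a"
    show "perp (Upm_obj Q) A \<subseteq> perp (Upm_obj Q) B"
    proof
      fix p assume "p \<in> perp (Upm_obj Q) A"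
      then have p: "p \<in> positions (carrier (Upm_obj Q))"
        "qle Q (pos_val Q p \<otimes>\<^bsub>Q\<^esub> ?a) (dualizer Q)"
        using A by (auto simp: mem_perp_Upm_iff)
      have v: "pos_val Q p \<in> carrier Q" using p positions_Upm_obj Q.pos_val_closed by blast
      have "qle Q (pos_val Q p \<otimes>\<^bsub>Q\<^esub> ?b) (dualizer Q)"
        by (rule Q.qle_trans[OF Q.mult_mono[OF le b a v] p(2)])
          (use a b v in \<open>auto simp: Q.dualizer_closed\<close>)
      then show "p \<in> perp (Upm_obj Q) B" using p B by (simp add: mem_perp_Upm_iff)
    qed
  }
qed

lemma perp_Upm_eq_iff:
  assumes A: "A \<subseteq> positions (carrier (Upm_obj Q))" and B: "B \<subseteq> positions (carrier (Upm_obj Q))"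
  shows "perp (Upm_obj Q) A = perp (Upm_obj Q) B \<longleftrightarrow>
    qjoin Q (pos_val Q ` A) = qjoin Q (pos_val Q ` B)"
proof -
  have "qjoin Q (pos_val Q ` A) \<in> carrier Q" "qjoin Q (pos_val Q ` B) \<in> carrier Q"
    using A B by (auto intro!: Q.qjoin_closed dest: pos_val_Upm_subset)
  then show ?thesis
    using perp_Upm_subset_iff[OF A B] perp_Upm_subset_iff[OF B A] Q.qle_antisym Q.qle_refl
    by (metis subset_antisym subset_refl)
qed

end

section \<open>Action of the right adjoint on morphisms\<close>

lemma Upm_map_eq: "Upm_map Q f = (\<lambda>x \<in> carrier (Upm_obj Q). map_prod f f x)"
  by (auto simp: Upm_map_def U_map_def Upm_obj_def frame_restrict_def restrict_def
      reflexive_points_def)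

text \<open>Taking values commutes with \<open>f\<close>, and \<open>f\<close> preserves joins, so
  the join of the values of an image is \<open>f\<close> of the original join. Continuity thereby
  reduces to monotonicity of \<open>f\<close>.\<close>

lemma Upm_map_in_if_hom:
  assumes Q: "girard_quantale Q" and R: "girard_quantale R" and f: "f \<in> gq_hom Q R"
  shows "Upm_map Q f \<in> if_hom (Upm_obj Q) (Upm_obj R)"
proof -
  interpret Q: girard_quantale Q by (rule Q)
  interpret R: girard_quantale R by (rule R)
  let ?P = "positions (carrier (Upm_obj Q))"
  have map: "Upm_map Q f \<in> carrier (Upm_obj Q) \<rightarrow>\<^sub>E carrier (Upm_obj R)"
  proof -
    \<comment> \<open>Reflexive pairs go to reflexive pairs: the product of the images is the image
      of the product, which stays below the dualizing element because \<open>f\<close> is lax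
      there.\<close>
    have "(f a, f b) \<in> carrier (Upm_obj R)" if "(a, b) \<in> carrier (Upm_obj Q)" for a b
      using that gq_hom_closed[OF f] gq_hom_mult[OF f, of a b]
        gq_hom_le_dualizer[OF Q R f, of "a \<otimes>\<^bsub>Q\<^esub> b"]
      by (simp add: mem_carrier_Upm_obj[OF Q] mem_carrier_Upm_obj[OF R])
    then show ?thesis unfolding Upm_map_eq by auto
  qed
  have closed: "pos_map (Upm_map Q f) p \<in> positions (carrier (Upm_obj R))" if "p \<in> ?P" for p
    using that map by (intro pos_map_closed[of _ "carrier (Upm_obj Q)"]) auto
  have val: "pos_val R (pos_map (Upm_map Q f) p) = f (pos_val Q p)" if "p \<in> ?P" for p
  proof -
    have "pos_map (Upm_map Q f) p = pos_map (map_prod f f) p"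
      using that by (rule pos_map_cong) (simp add: Upm_map_eq)
    then show ?thesis
      using gq_hom_pos_val[OF Q R f positions_Upm_obj[OF that]] by simp
  qed
  have join: "qjoin R (pos_val R ` pos_map (Upm_map Q f) ` A) = f (qjoin Q (pos_val Q ` A))"
    if "A \<subseteq> ?P" for A
  proof -
    have "pos_val R ` pos_map (Upm_map Q f) ` A = f ` pos_val Q ` A"
      unfolding image_image using that val by (intro image_cong) auto
    then show ?thesis
      using gq_hom_qjoin[OF f pos_val_Upm_subset[OF Q that]] by simp
  qed
  have "perp (Upm_obj R) (pos_map (Upm_map Q f) ` A) \<subseteq> perp (Upm_obj R) (pos_map (Upm_map Q f) ` B)"
    if A: "A \<subseteq> ?P" and B: "B \<subseteq> ?P" and le: "perp (Upm_obj Q) A \<subseteq> perp (Upm_obj Q) B" for A B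
  proof -
    have "qle R (f (qjoin Q (pos_val Q ` B))) (f (qjoin Q (pos_val Q ` A)))"
      using le pos_val_Upm_subset[OF Q A] pos_val_Upm_subset[OF Q B]
      by (intro gq_hom_mono[OF Q.comm_quantale_axioms R.comm_quantale_axioms f])
        (auto simp: perp_Upm_subset_iff[OF Q A B] intro!: Q.qjoin_closed)
    then show ?thesis
      using A B closed by (subst perp_Upm_subset_iff[OF R]) (auto simp: join)
  qed
  moreover have "pos_map (Upm_map Q f) ` falsum (Upm_obj Q) \<subseteq> falsum (Upm_obj R)"
  proof (rule image_subsetI)
    fix p assume "p \<in> falsum (Upm_obj Q)"
    then have p: "p \<in> ?P" "qle Q (pos_val Q p) (dualizer Q)"
      by (simp_all add: falsum_Upm_obj)
    show "pos_map (Upm_map Q f) p \<in> falsum (Upm_obj R)"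
      using closed[OF p(1)] val[OF p(1)]
        gq_hom_le_dualizer[OF Q R f p(2) Q.pos_val_closed[OF positions_Upm_obj[OF p(1)]]]
      by (simp add: falsum_Upm_obj)
  qed
  ultimately show ?thesis
    using map by (simp add: if_hom_def)
qed

lemma Upm_map_ident:
  "Upm_map Q (\<lambda>a \<in> carrier Q. a) = (\<lambda>x \<in> carrier (Upm_obj Q). x)"
  unfolding Upm_map_eq using carrier_Upm_obj_subset[of Q] by (intro restrict_ext) auto

lemma Upm_map_compose:
  assumes "girard_quantale Q" "girard_quantale R" "f \<in> gq_hom Q R"
  shows "Upm_map Q (compose (carrier Q) g f) =
    compose (carrier (Upm_obj Q)) (Upm_map R g) (Upm_map Q f)"
  unfolding Upm_map_eq[of Q "compose (carrier Q) g f"] compose_def[of "carrier (Upm_obj Q)"]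
proof (rule restrict_ext)
  fix x assume x: "x \<in> carrier (Upm_obj Q)"
  \<comment> \<open>The extensional function \<open>Upm_map R g\<close> acts componentwise only on
    \<open>carrier (Upm_obj R)\<close>, so membership of the intermediate pair comes first.\<close>
  then have "Upm_map Q f x \<in> carrier (Upm_obj R)"
    using Upm_map_in_if_hom[OF assms] by (rule if_hom_closed[rotated])
  then show "map_prod (compose (carrier Q) g f) (compose (carrier Q) g f) x =
      Upm_map R g (Upm_map Q f x)"
    using x carrier_Upm_obj_subset[of Q] by (cases x) (auto simp: Upm_map_eq compose_def)
qed

subsection \<open>The adjunction\<close>

text \<open>Closing singletons is a monoid homomorphism from positions to closed sets, by the
  nucleus property. Values of transposed positions are computed along it.\<close>

lemma biperp_singleton_add:
  assumes "p \<in> positions (carrier X)" "q \<in> positions (carrier X)"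
  shows "biperp X {p + q} = biperp X {p} \<otimes>\<^bsub>F_obj X\<^esub> biperp X {q}"
proof -
  have "perp X (biperp X {p} + biperp X {q}) = perp X ({p} + {q})"
    using assms by (simp add: perp_set_add_biperp_left perp_set_add_biperp_right perp_subset)
  then show ?thesis by (simp add: set_plus_def)
qed

section \<open>From quantale morphisms to frame morphisms\<close>

context
  fixes X :: "'x iframe" and Q :: "'a girard"
  assumes X: "reflexive_frame X" and Q: "girard_quantale Q"
begin

interpretation Q: girard_quantale Q by (rule Q)

lemma implication_frame_X: "implication_frame X"
  using X by (simp add: reflexive_frame_def)

interpretation F: girard_quantale "F_obj X"
  by (rule F_obj_girard_quantale) (rule implication_frame_X)

text \<open>Reflexivity of \<open>X\<close> enters here. It puts the closure of ({x}, {x}) below the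
  dualizing element of \<open>F_obj X\<close>; this closure is the product of the two generators at
  x, so \<open>g\<close> sends them to a reflexive pair.\<close>

lemma adj_transpose_closed:
  assumes g: "g \<in> gq_hom (F_obj X) Q"
  shows "adj_transpose X g \<in> carrier X \<rightarrow>\<^sub>E carrier (Upm_obj Q)"
proof -
  have "(g (biperp X {({#x#}, {#})}), g (biperp X {({#}, {#x#})})) \<in> carrier (Upm_obj Q)"
    if x: "x \<in> carrier X" for x
  proof -
    have "({#x#}, {#x#}) \<in> falsum X"
      using X x by (auto simp: reflexive_frame_def reflexive_points_def)
    then have "biperp X {({#x#}, {#x#})} \<subseteq> falsum X"
      using falsum_in_F_obj[OF implication_frame_X] by (intro biperp_least) auto
    then have "qle Q (g (biperp X {({#x#}, {#x#})})) (dualizer Q)"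
      using gq_hom_le_dualizer[OF F.girard_quantale_axioms Q g _ biperp_in_F_obj] by simp
    moreover have "biperp X {({#x#}, {#x#})} =
        biperp X {({#x#}, {#})} \<otimes>\<^bsub>F_obj X\<^esub> biperp X {({#}, {#x#})}"
      using biperp_singleton_add[OF positions_left positions_right, OF x x] by simp
    ultimately show ?thesis
      using gq_hom_mult[OF g biperp_in_F_obj biperp_in_F_obj] gq_hom_closed[OF g biperp_in_F_obj]
      by (simp only: mem_carrier_Upm_obj[OF Q])
  qed
  then show ?thesis by (auto simp: adj_transpose_def)
qed

text \<open>Both sides are multiplicative in \<open>p\<close>, and on singletons the equation is the
  definition of the transpose.\<close>

lemma pos_val_adj_transpose:
  assumes g: "g \<in> gq_hom (F_obj X) Q" and p: "p \<in> positions (carrier X)"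
  shows "pos_val Q (pos_map (adj_transpose X g) p) = g (biperp X {p})"
proof -
  let ?t = "adj_transpose X g"
  have "?t ` carrier X \<subseteq> carrier Q \<times> carrier Q"
    using adj_transpose_closed[OF g] carrier_Upm_obj_subset[of Q] by blast
  note closed = pos_map_closed[OF this]
  note gc = gq_hom_closed[OF g biperp_in_F_obj]
  note gm = gq_hom_mult[OF g biperp_in_F_obj biperp_in_F_obj, symmetric]
  from p show ?thesis
  proof (induction rule: positions_induct)
    case zero
    show ?case using gq_hom_one[OF g] by (simp add: pos_map_0 Q.pos_val_0)
  next
    case (left x p)
    have "pos_val Q (pos_map ?t ({#x#}, {#})) = g (biperp X {({#x#}, {#})})"
      using left(1) gc by (simp add: adj_transpose_def Q.pos_val_left)
    then show ?case
      unfolding pos_map_add biperp_singleton_add[OF positions_left[OF left(1)] left(2)]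
      using Q.pos_val_add[OF closed[OF positions_left[OF left(1)]] closed[OF left(2)]] left(3)
      by (simp only: gm)
  next
    case (right x p)
    have "pos_val Q (pos_map ?t ({#}, {#x#})) = g (biperp X {({#}, {#x#})})"
      using right(1) gc by (simp add: adj_transpose_def Q.pos_val_right)
    then show ?case
      unfolding pos_map_add biperp_singleton_add[OF positions_right[OF right(1)] right(2)]
      using Q.pos_val_add[OF closed[OF positions_right[OF right(1)]] closed[OF right(2)]] right(3)
      by (simp only: gm)
  qed
qed

text \<open>The closure of \<open>A\<close> is the join of the closures of its singletons, and
  \<open>g\<close> preserves this join. Hence \<open>g\<close> is determined by its
  transpose.\<close>

lemma gq_hom_biperp_eq_qjoin:
  assumes g: "g \<in> gq_hom (F_obj X) Q" and A: "A \<subseteq> positions (carrier X)"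
  shows "g (biperp X A) = qjoin Q (pos_val Q ` pos_map (adj_transpose X g) ` A)"
proof -
  have sub: "(\<lambda>p. biperp X {p}) ` A \<subseteq> carrier (F_obj X)" using biperp_in_F_obj by blast
  have "perp X (\<Union>p\<in>A. biperp X {p}) = perp X (\<Union>p\<in>A. {p})"
    using A by (intro perp_UN_biperp) auto
  then have "biperp X A = qjoin (F_obj X) ((\<lambda>p. biperp X {p}) ` A)"
    using sub by (simp only: F_obj_qjoin) simp
  also have "g \<dots> = qjoin Q (g ` (\<lambda>p. biperp X {p}) ` A)"
    using g sub by (rule gq_hom_qjoin)
  also have "g ` (\<lambda>p. biperp X {p}) ` A = pos_val Q ` pos_map (adj_transpose X g) ` A"
    unfolding image_image using A pos_val_adj_transpose[OF g] by (intro image_cong) auto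
  finally show ?thesis .
qed

lemma adj_transpose_in_if_hom:
  assumes g: "g \<in> gq_hom (F_obj X) Q"
  shows "adj_transpose X g \<in> if_hom X (Upm_obj Q)"
proof -
  let ?t = "adj_transpose X g"
  note map = adj_transpose_closed[OF g]
  have closed: "pos_map ?t p \<in> positions (carrier (Upm_obj Q))"
    if "p \<in> positions (carrier X)" for p
    using that map by (intro pos_map_closed[of _ "carrier X"]) auto
  have "perp (Upm_obj Q) (pos_map ?t ` A) \<subseteq> perp (Upm_obj Q) (pos_map ?t ` B)"
    if A: "A \<subseteq> positions (carrier X)" and B: "B \<subseteq> positions (carrier X)"
      and le: "perp X A \<subseteq> perp X B" for A B
  proof -
    \<comment> \<open>Taking orthogonals once more makes the hypothesis an inequality in
      \<open>F_obj X\<close>, which \<open>g\<close> preserves; \<open>perp_Upm_subset_iff\<close>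
      reads the result back as an inclusion of orthogonals.\<close>
    have "qle (F_obj X) (biperp X B) (biperp X A)" using perp_antimono[OF le] by simp
    then have "qle Q (g (biperp X B)) (g (biperp X A))"
      by (rule gq_hom_mono[OF F.comm_quantale_axioms Q.comm_quantale_axioms g _
          biperp_in_F_obj biperp_in_F_obj])
    moreover have "pos_map ?t ` C \<subseteq> positions (carrier (Upm_obj Q))"
      if "C \<subseteq> positions (carrier X)" for C
      using that by (intro image_subsetI closed) (rule subsetD)
    ultimately show ?thesis
      using A B by (simp only: perp_Upm_subset_iff[OF Q] gq_hom_biperp_eq_qjoin[OF g])
  qed
  moreover have "pos_map ?t ` falsum X \<subseteq> falsum (Upm_obj Q)"
  proof (rule image_subsetI)
    fix p assume p: "p \<in> falsum X"
    have pp: "p \<in> positions (carrier X)"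
      using p implication_frame_X by (auto simp: implication_frame_def)
    have "biperp X {p} \<subseteq> falsum X"
      using p falsum_in_F_obj[OF implication_frame_X] by (intro biperp_least) auto
    then have "qle Q (g (biperp X {p})) (dualizer Q)"
      using gq_hom_le_dualizer[OF F.girard_quantale_axioms Q g _ biperp_in_F_obj] by simp
    then show "pos_map ?t p \<in> falsum (Upm_obj Q)"
      using closed[OF pp] pos_val_adj_transpose[OF g pp] by (simp add: falsum_Upm_obj)
  qed
  ultimately show ?thesis
    using map by (simp add: if_hom_def)
qed

section \<open>From frame morphisms to quantale morphisms\<close>

text \<open>The formula is forced: by \<open>gq_hom_biperp_eq_qjoin\<close>, any morphism with
  transpose \<open>t\<close> has these values.\<close>

definition adj_untranspose :: "('x \<Rightarrow> 'a \<times> 'a) \<Rightarrow> 'x position set \<Rightarrow> 'a" where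
  "adj_untranspose t = (\<lambda>A \<in> carrier (F_obj X). qjoin Q (pos_val Q ` pos_map t ` A))"

text \<open>Continuity of \<open>t\<close> gives the images of \<open>A\<close> and of its closure
  the same orthogonal, and by \<open>perp_Upm_eq_iff\<close> the same join of values.\<close>

lemma adj_untranspose_biperp:
  assumes t: "t \<in> if_hom X (Upm_obj Q)" and A: "A \<subseteq> positions (carrier X)"
  shows "adj_untranspose t (biperp X A) = qjoin Q (pos_val Q ` pos_map t ` A)"
proof -
  have "perp (Upm_obj Q) (pos_map t ` biperp X A) = perp (Upm_obj Q) (pos_map t ` A)"
    using t A by (rule if_hom_perp_biperp)
  then have "qjoin Q (pos_val Q ` pos_map t ` biperp X A) = qjoin Q (pos_val Q ` pos_map t ` A)"
    using if_hom_pos_map_closed[OF t perp_subset] if_hom_pos_map_closed[OF t A]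
    by (simp only: perp_Upm_eq_iff[OF Q])
  then show ?thesis
    by (simp only: adj_untranspose_def restrict_apply biperp_in_F_obj if_True)
qed

text \<open>Joins and products of closed sets are closures of unions and sums, and
  \<open>adj_untranspose_biperp\<close> discards these closures. What remains is flattening of
  joins, multiplicativity of values and distributivity.\<close>

lemma adj_untranspose_in_gq_hom:
  assumes t: "t \<in> if_hom X (Upm_obj Q)"
  shows "adj_untranspose t \<in> gq_hom (F_obj X) Q"
proof -
  let ?v = "\<lambda>p. pos_val Q (pos_map t p)"
  have pc: "pos_map t p \<in> positions (carrier Q \<times> carrier Q)" if "p \<in> positions (carrier X)" for p
    using if_hom_pos_map_closed[OF t, of "{p}"] that by (intro positions_Upm_obj) simp
  have vc: "?v ` A \<subseteq> carrier Q" if "A \<subseteq> positions (carrier X)" for A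
    using that by (intro image_subsetI Q.pos_val_closed pc) (rule subsetD)
  have ap: "adj_untranspose t A = qjoin Q (?v ` A)" if "A \<in> carrier (F_obj X)" for A
    using that by (simp add: adj_untranspose_def image_image)
  have bp: "adj_untranspose t (biperp X A) = qjoin Q (?v ` A)"
    if "A \<subseteq> positions (carrier X)" for A
    using adj_untranspose_biperp[OF t that] by (simp add: image_image)
  have "adj_untranspose t \<in> carrier (F_obj X) \<rightarrow>\<^sub>E carrier Q"
  proof (rule PiE_I)
    fix A assume A: "A \<in> carrier (F_obj X)"
    then have "A \<subseteq> positions (carrier X)" by simp
    then show "adj_untranspose t A \<in> carrier Q" using ap[OF A] vc Q.qjoin_closed by simp
  qed (simp add: adj_untranspose_def del: F_obj_simps(1))
  moreover have "adj_untranspose t (qjoin (F_obj X) \<A>) = qjoin Q (adj_untranspose t ` \<A>)"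
    if \<A>: "\<A> \<subseteq> carrier (F_obj X)" for \<A>
  proof -
    have s: "\<Union>\<A> \<subseteq> positions (carrier X)" using \<A> by auto
    have "adj_untranspose t (qjoin (F_obj X) \<A>) = qjoin Q (?v ` \<Union>\<A>)"
      using \<A> s bp by (simp only: F_obj_qjoin)
    also have "?v ` \<Union>\<A> = (\<Union>A\<in>\<A>. ?v ` A)" by auto
    also have "qjoin Q \<dots> = qjoin Q ((\<lambda>A. qjoin Q (?v ` A)) ` \<A>)"
      using s by (intro Q.qjoin_UN vc) auto
    also have "(\<lambda>A. qjoin Q (?v ` A)) ` \<A> = adj_untranspose t ` \<A>"
      using \<A> ap by (intro image_cong) (auto simp del: F_obj_simps)
    finally show ?thesis .
  qed
  moreover have "adj_untranspose t (A \<otimes>\<^bsub>F_obj X\<^esub> B) =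
      adj_untranspose t A \<otimes>\<^bsub>Q\<^esub> adj_untranspose t B"
    if AB: "A \<in> carrier (F_obj X)" "B \<in> carrier (F_obj X)" for A B
  proof -
    have s: "A \<subseteq> positions (carrier X)" "B \<subseteq> positions (carrier X)" using AB by auto
    have *: "?v (p + q) = ?v p \<otimes>\<^bsub>Q\<^esub> ?v q" if "p \<in> A" "q \<in> B" for p q
      using that s pc by (simp add: pos_map_add Q.pos_val_add subsetD)
    have "adj_untranspose t (A \<otimes>\<^bsub>F_obj X\<^esub> B) = qjoin Q (?v ` (A + B))"
      using s bp by (simp only: F_obj_simps positions_set_add)
    also have "?v ` (A + B) = {a \<otimes>\<^bsub>Q\<^esub> b |a b. a \<in> ?v ` A \<and> b \<in> ?v ` B}"
    proof (intro subset_antisym subsetI)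
      fix c assume "c \<in> ?v ` (A + B)"
      then obtain p q where "p \<in> A" "q \<in> B" "c = ?v (p + q)"
        by (elim imageE set_plus_elim) simp
      then show "c \<in> {a \<otimes>\<^bsub>Q\<^esub> b |a b. a \<in> ?v ` A \<and> b \<in> ?v ` B}"
        using * by blast
    next
      fix c assume "c \<in> {a \<otimes>\<^bsub>Q\<^esub> b |a b. a \<in> ?v ` A \<and> b \<in> ?v ` B}"
      then obtain p q where "p \<in> A" "q \<in> B" "c = ?v p \<otimes>\<^bsub>Q\<^esub> ?v q" by blast
      then show "c \<in> ?v ` (A + B)"
        by (simp add: set_plus_intro flip: *)
    qed
    also have "qjoin Q \<dots> = qjoin Q (?v ` A) \<otimes>\<^bsub>Q\<^esub> qjoin Q (?v ` B)"
      using vc s by (simp add: Q.mult_qjoin_qjoin)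
    finally show ?thesis using AB by (simp only: ap)
  qed
  moreover have "adj_untranspose t \<one>\<^bsub>F_obj X\<^esub> = \<one>\<^bsub>Q\<^esub>"
    using bp[of "{0}"] by (simp add: positions_0 pos_map_0 Q.pos_val_0 Q.qjoin_singleton)
  moreover have "qle Q (adj_untranspose t (falsum X)) (dualizer Q)"
  proof -
    have "falsum X \<subseteq> positions (carrier X)"
      using implication_frame_X by (simp add: implication_frame_def)
    then have "qle Q (qjoin Q (?v ` falsum X)) (dualizer Q)"
    proof (intro Q.qjoin_least vc Q.dualizer_closed)
      fix a assume "a \<in> ?v ` falsum X"
      then obtain p where "p \<in> falsum X" "a = ?v p" by blast
      then show "qle Q a (dualizer Q)"
        using if_hom_falsum[OF t] by (simp add: falsum_Upm_obj image_subset_iff)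
    qed
    then show ?thesis using falsum_in_F_obj[OF implication_frame_X] by (simp only: ap)
  qed
  ultimately show ?thesis
    by (simp add: gq_hom_def del: F_obj_simps(1-3))
qed

text \<open>At the closure of a singleton position the join ranges over one value, which is a
  component of \<open>t x\<close>.\<close>

lemma adj_transpose_untranspose:
  assumes t: "t \<in> if_hom X (Upm_obj Q)"
  shows "adj_transpose X (adj_untranspose t) = t"
proof (rule extensionalityI[of _ "carrier X"])
  show "adj_transpose X (adj_untranspose t) \<in> extensional (carrier X)"
    by (simp add: adj_transpose_def)
  show "t \<in> extensional (carrier X)"
    using t by (auto simp: if_hom_def PiE_def)
  fix x assume x: "x \<in> carrier X"
  then have "t x \<in> carrier Q \<times> carrier Q"
    using if_hom_closed[OF t] carrier_Upm_obj_subset[of Q] by blast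
  then obtain a b where tx: "t x = (a, b)" "a \<in> carrier Q" "b \<in> carrier Q" by auto
  have "adj_untranspose t (biperp X {({#x#}, {#})}) = a"
    "adj_untranspose t (biperp X {({#}, {#x#})}) = b"
    using x tx by (simp_all add: adj_untranspose_biperp[OF t] positions_left positions_right
        Q.pos_val_left Q.pos_val_right Q.qjoin_singleton)
  then show "adj_transpose X (adj_untranspose t) x = t x"
    using x tx by (simp add: adj_transpose_def)
qed

lemma adj_untranspose_transpose:
  assumes g: "g \<in> gq_hom (F_obj X) Q"
  shows "adj_untranspose (adj_transpose X g) = g"
proof (rule extensionalityI[of _ "carrier (F_obj X)"])
  show "adj_untranspose (adj_transpose X g) \<in> extensional (carrier (F_obj X))"
    by (simp add: adj_untranspose_def)
  show "g \<in> extensional (carrier (F_obj X))"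
    using g by (auto simp: gq_hom_def PiE_def)
  fix A assume "A \<in> carrier (F_obj X)"
  then show "adj_untranspose (adj_transpose X g) A = g A"
    using gq_hom_biperp_eq_qjoin[OF g, of A] by (simp add: adj_untranspose_def)
qed

lemma bij_betw_adj_transpose:
  "bij_betw (adj_transpose X) (gq_hom (F_obj X) Q) (if_hom X (Upm_obj Q))"
  by (rule bij_betwI[of _ _ _ adj_untranspose])
    (auto intro: adj_transpose_in_if_hom adj_untranspose_in_gq_hom
      adj_transpose_untranspose adj_untranspose_transpose)

section \<open>Naturality\<close>

lemma adj_transpose_natural_right:
  assumes g: "g \<in> gq_hom (F_obj X) Q"
  shows "adj_transpose X (compose (carrier (F_obj X)) k g) =
    compose (carrier X) (Upm_map Q k) (adj_transpose X g)"
proof (rule extensionalityI[of _ "carrier X"])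
  fix x assume x: "x \<in> carrier X"
  \<comment> \<open>Only on reflexive pairs does \<open>Upm_map Q k\<close> apply \<open>k\<close>
    to both components.\<close>
  then have "adj_transpose X g x \<in> carrier (Upm_obj Q)"
    using adj_transpose_closed[OF g] by blast
  then show "adj_transpose X (compose (carrier (F_obj X)) k g) x =
      compose (carrier X) (Upm_map Q k) (adj_transpose X g) x"
    using x biperp_in_F_obj[of X]
    by (simp add: Upm_map_eq compose_def adj_transpose_def del: F_obj_simps)
qed (simp_all add: adj_transpose_def compose_def)

end

text \<open>By continuity of \<open>h\<close>, the map \<open>F_map X Y h\<close> sends the
  generators at x to the generators at \<open>h x\<close>, and the transpose sees only the
  generators.\<close>

lemma adj_transpose_natural_left:
  assumes h: "h \<in> if_hom X Y"
  shows "adj_transpose X (compose (carrier (F_obj X)) g (F_map X Y h)) =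
    compose (carrier X) (adj_transpose Y g) h"
proof (rule extensionalityI[of _ "carrier X"])
  fix x assume x: "x \<in> carrier X"
  have "F_map X Y h (biperp X {({#x#}, {#})}) = biperp Y {({#h x#}, {#})}"
    "F_map X Y h (biperp X {({#}, {#x#})}) = biperp Y {({#}, {#h x#})}"
    using x by (simp_all add: F_map_biperp[OF h] positions_left positions_right)
  then show "adj_transpose X (compose (carrier (F_obj X)) g (F_map X Y h)) x =
      compose (carrier X) (adj_transpose Y g) h x"
    using x if_hom_closed[OF h x] biperp_in_F_obj[of X]
    by (simp add: compose_def adj_transpose_def del: F_obj_simps)
qed (simp_all add: adj_transpose_def compose_def)

theorem lemma3p3:
  fixes Q :: "'a girard" and R :: "'b girard" and S :: "'c girard"
    and X :: "'x iframe" and Y :: "'y iframe" and Z :: "'z iframe"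
  assumes "girard_quantale Q" and "girard_quantale R" and "girard_quantale S"
    and "reflexive_frame X" and "reflexive_frame Y" and "reflexive_frame Z"
  shows
    "\<comment> \<open>the right adjoint is a functor from Girard quantales to reflexive frames\<close>
     (reflexive_frame (Upm_obj Q) \<and>
      (\<forall>f \<in> gq_hom Q R. Upm_map Q f \<in> if_hom (Upm_obj Q) (Upm_obj R)) \<and>
      Upm_map Q (\<lambda>a \<in> carrier Q. a) = (\<lambda>x \<in> carrier (Upm_obj Q). x) \<and>
      (\<forall>f \<in> gq_hom Q R. \<forall>g \<in> gq_hom R S.
         Upm_map Q (compose (carrier Q) g f) =
         compose (carrier (Upm_obj Q)) (Upm_map R g) (Upm_map Q f))) \<and>
     \<comment> \<open>the left adjoint is a functor from reflexive frames to Girard quantales\<close>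
     (girard_quantale (F_obj X) \<and>
      (\<forall>f \<in> if_hom X Y. F_map X Y f \<in> gq_hom (F_obj X) (F_obj Y)) \<and>
      F_map X X (\<lambda>x \<in> carrier X. x) = (\<lambda>A \<in> carrier (F_obj X). A) \<and>
      (\<forall>f \<in> if_hom X Y. \<forall>g \<in> if_hom Y Z.
         F_map X Z (compose (carrier X) g f) =
         compose (carrier (F_obj X)) (F_map Y Z g) (F_map X Y f))) \<and>
     \<comment> \<open>bijection of hom-sets, natural in the frame and in the quantale\<close>
     (bij_betw (adj_transpose X) (gq_hom (F_obj X) Q) (if_hom X (Upm_obj Q)) \<and>
      (\<forall>h \<in> if_hom X Y. \<forall>g \<in> gq_hom (F_obj Y) Q.
         adj_transpose X (compose (carrier (F_obj X)) g (F_map X Y h)) =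
         compose (carrier X) (adj_transpose Y g) h) \<and>
      (\<forall>g \<in> gq_hom (F_obj X) Q. \<forall>k \<in> gq_hom Q R.
         adj_transpose X (compose (carrier (F_obj X)) k g) =
         compose (carrier X) (Upm_map Q k) (adj_transpose X g)))"
proof (intro conjI ballI)
  note XYZ = assms(4-6)[unfolded reflexive_frame_def, THEN conjunct1]
  show "reflexive_frame (Upm_obj Q)" by (rule Upm_obj_reflexive_frame)
  show "Upm_map Q (\<lambda>a \<in> carrier Q. a) = (\<lambda>x \<in> carrier (Upm_obj Q). x)" by (rule Upm_map_ident)
  show "girard_quantale (F_obj X)" using XYZ(1) by (rule F_obj_girard_quantale)
  show "F_map X X (\<lambda>x \<in> carrier X. x) = (\<lambda>A \<in> carrier (F_obj X). A)" by (rule F_map_ident)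
  show "bij_betw (adj_transpose X) (gq_hom (F_obj X) Q) (if_hom X (Upm_obj Q))"
    using assms(4,1) by (rule bij_betw_adj_transpose)
qed (use assms in \<open>auto intro: Upm_map_in_if_hom Upm_map_compose F_map_in_gq_hom F_map_compose
    adj_transpose_natural_left adj_transpose_natural_right simp: reflexive_frame_def
    simp del: F_obj_simps\<close>)

end
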